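(* Let $G$ be a positive-dimensional connected commutative algebraic group over $\mathbb{C}$, let $\gamma_1,\ldots,\gamma_l\in G$, and let $S_1\ge\cdots\ge S_l\ge1$ be real numbers, $\underline S=(S_1,\ldots,S_l)$. Let $\{0\}=H_0\subsetneq\cdots\subsetneq H_r=G$ be the associated chain of connected algebraic subgroups (see context). For every $i\in\{1,\ldots,r-1\}$, $$\frac{\varphi_{\underline S}(H_{i+1})-\varphi_{\underline S}(H_i)}{\dim H_{i+1}-\dim H_i}<\frac{\varphi_{\underline S}(H_i)-\varphi_{\underline S}(H_{i-1})}{\dim H_i-\dim H_{i-1}}.$$
   Context: For $0\le j\le l$, $\Gamma_j$ is the subgroup of $G$ generated by $\gamma_1,\ldots,\gamma_j$ (with $\Gamma_0=\{0\}$). For a connected algebraic subgroup $K$ of $G$, $\varphi_{\underline S}(K)=\sum_{j=1}^l\big(\mathrm{rk}(\Gamma_j\cap K)-\mathrm{rk}(\Gamma_{j-1}\cap K)\big)\log S_j$. The associated chain $\{0\}=H_0\subsetneq H_1\subsetneq\cdots\subsetneq H_r=G$ ($r\ge1$) is the unique chain of connected algebraic subgroups of $G$ such that for every $i\in\{0,\ldots,r-1\}$ and every connected algebraic subgroup $K$ of $G$ with $\dim K>\dim H_i$, $$\frac{\varphi_{\underline S}(K)-\varphi_{\underline S}(H_i)}{\dim K-\dim H_i}\le\frac{\varphi_{\underline S}(H_{i+1})-\varphi_{\underline S}(H_i)}{\dim H_{i+1}-\dim H_i},$$ and equality implies $H_i\subset K\subset H_{i+1}$. Existence and uniqueness of this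 chain may be taken as known. *)

theory Defs
  imports "HOL-Analysis.Abstract_Topology" "HOL-Algebra.FiniteProduct" "HOL-Algebra.Generated_Groups"
begin

section \<open>Algebraic varieties over the complex numbers\<close>

text \<open>
  Varieties are treated classically, as spaces with functions in the sense of Serre: a
  topological space of closed points with a sheaf of complex-valued functions, which is locally
  isomorphic to Zariski closed subsets of affine spaces. In characteristic 0 every group scheme of
  finite type is reduced, so this loses no generality for algebraic groups and their algebraic
  subgroups.
\<close>

subsection \<open>Affine space\<close>

abbreviation affine_space :: "nat \<Rightarrow> (nat \<Rightarrow> complex) set" where
  "affine_space n \<equiv> {..<n} \<rightarrow>\<^sub>E UNIV"

text \<open>Polynomials in the coordinates \<open>x 0, \<dots>, x (n - 1)\<close>, identified with the functions they define
  (the ground field is infinite).\<close>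

inductive_set poly_funs :: "nat \<Rightarrow> ((nat \<Rightarrow> complex) \<Rightarrow> complex) set" for n where
  const: "(\<lambda>_. c) \<in> poly_funs n"
| coord: "i < n \<Longrightarrow> (\<lambda>x. x i) \<in> poly_funs n"
| add: "p \<in> poly_funs n \<Longrightarrow> q \<in> poly_funs n \<Longrightarrow> (\<lambda>x. p x + q x) \<in> poly_funs n"
| mult: "p \<in> poly_funs n \<Longrightarrow> q \<in> poly_funs n \<Longrightarrow> (\<lambda>x. p x * q x) \<in> poly_funs n"

definition zariski :: "nat \<Rightarrow> (nat \<Rightarrow> complex) topology" where
  "zariski n = topology_generated_by {{x \<in> affine_space n. p x \<noteq> 0} | p. p \<in> poly_funs n}"

subsection \<open>Spaces with functions\<close>

text \<open>\<open>regular X U\<close> is only meaningful for open \<open>U\<close>. A function on \<open>U\<close> is represented by any of its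
  extensions to the whole type.\<close>

record 'a function_space =
  top_of :: "'a topology"
  regular :: "'a set \<Rightarrow> ('a \<Rightarrow> complex) set"

definition space_with_functions :: "'a function_space \<Rightarrow> bool" where
  "space_with_functions X \<longleftrightarrow>
     (\<forall>U f g. openin (top_of X) U \<and> f \<in> regular X U \<and> (\<forall>x\<in>U. g x = f x) \<longrightarrow> g \<in> regular X U) \<and>
     (\<forall>U c. openin (top_of X) U \<longrightarrow> (\<lambda>_. c) \<in> regular X U) \<and>
     (\<forall>U f g. openin (top_of X) U \<and> f \<in> regular X U \<and> g \<in> regular X U \<longrightarrow>
        (\<lambda>x. f x + g x) \<in> regular X U \<and> (\<lambda>x. f x * g x) \<in> regular X U) \<and>
     (\<forall>U W f. openin (top_of X) U \<and> openin (top_of X) W \<and> W \<subseteq> U \<and> f \<in> regular X U \<longrightarrow>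
        f \<in> regular X W) \<and>
     (\<forall>\<U> f. (\<forall>U\<in>\<U>. openin (top_of X) U \<and> f \<in> regular X U) \<longrightarrow> f \<in> regular X (\<Union>\<U>))"

definition morphism :: "'a function_space \<Rightarrow> 'b function_space \<Rightarrow> ('a \<Rightarrow> 'b) \<Rightarrow> bool" where
  "morphism X Y \<phi> \<longleftrightarrow>
     continuous_map (top_of X) (top_of Y) \<phi> \<and>
     (\<forall>V f. openin (top_of Y) V \<and> f \<in> regular Y V \<longrightarrow>
        (\<lambda>x. f (\<phi> x)) \<in> regular X {x \<in> topspace (top_of X). \<phi> x \<in> V})"

definition isomorphic :: "'a function_space \<Rightarrow> 'b function_space \<Rightarrow> bool" where
  "isomorphic X Y \<longleftrightarrow>
     (\<exists>\<phi> \<psi>. morphism X Y \<phi> \<and> morphism Y X \<psi> \<and>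
        (\<forall>x\<in>topspace (top_of X). \<psi> (\<phi> x) = x) \<and> (\<forall>y\<in>topspace (top_of Y). \<phi> (\<psi> y) = y))"

definition open_subspace :: "'a function_space \<Rightarrow> 'a set \<Rightarrow> 'a function_space" where
  "open_subspace X U = \<lparr>top_of = subtopology (top_of X) U, regular = regular X\<rparr>"

definition affine_model :: "nat \<Rightarrow> (nat \<Rightarrow> complex) set \<Rightarrow> (nat \<Rightarrow> complex) function_space" where
  "affine_model n V =
     \<lparr>top_of = subtopology (zariski n) V,
      regular = (\<lambda>U. {f. \<forall>x\<in>U. \<exists>W. openin (subtopology (zariski n) V) W \<and> x \<in> W \<and> W \<subseteq> U \<and>
        (\<exists>p\<in>poly_funs n. \<exists>q\<in>poly_funs n. \<forall>y\<in>W. q y \<noteq> 0 \<and> f y = p y / q y)})\<rparr>"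

definition affine_variety :: "'a function_space \<Rightarrow> bool" where
  "affine_variety X \<longleftrightarrow> (\<exists>n V. closedin (zariski n) V \<and> isomorphic X (affine_model n V))"

definition prevariety :: "'a function_space \<Rightarrow> bool" where
  "prevariety X \<longleftrightarrow> space_with_functions X \<and>
     (\<exists>\<U>. finite \<U> \<and> \<Union>\<U> = topspace (top_of X) \<and>
        (\<forall>U\<in>\<U>. openin (top_of X) U \<and> affine_variety (open_subspace X U)))"

text \<open>
  The product of prevarieties. On \<open>U \<times> V\<close>, with \<open>U\<close> and \<open>V\<close> open, every element of
  \<open>O(U) \<otimes> O(V)\<close> has to be regular. The non-vanishing loci of these functions form a basis of the
  topology (which is finer than the product topology), and the regular functions are locally their
  quotients.
\<close>

definition tensor_funs ::
  "'a function_space \<Rightarrow> 'b function_space \<Rightarrow> 'a set \<Rightarrow> 'b set \<Rightarrow> ('a \<times> 'b \<Rightarrow> complex) set" where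
  "tensor_funs X Y U V =
     {(\<lambda>(x, y). \<Sum>i<m. f i x * g i y) | (m::nat) f g. \<forall>i<m. f i \<in> regular X U \<and> g i \<in> regular Y V}"

definition variety_product_topology ::
  "'a function_space \<Rightarrow> 'b function_space \<Rightarrow> ('a \<times> 'b) topology" where
  "variety_product_topology X Y = topology_generated_by
     {{z \<in> U \<times> V. h z \<noteq> 0} | U V h.
        openin (top_of X) U \<and> openin (top_of Y) V \<and> h \<in> tensor_funs X Y U V}"

definition variety_product ::
  "'a function_space \<Rightarrow> 'b function_space \<Rightarrow> ('a \<times> 'b) function_space" where
  "variety_product X Y =
     \<lparr>top_of = variety_product_topology X Y,
      regular = (\<lambda>N. {f. \<forall>z\<in>N. \<exists>W U V. openin (variety_product_topology X Y) W \<and> z \<in> W \<and> W \<subseteq> N \<and>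
        openin (top_of X) U \<and> openin (top_of Y) V \<and> W \<subseteq> U \<times> V \<and>
        (\<exists>p\<in>tensor_funs X Y U V. \<exists>q\<in>tensor_funs X Y U V. \<forall>w\<in>W. q w \<noteq> 0 \<and> f w = p w / q w)})\<rparr>"

definition variety :: "'a function_space \<Rightarrow> bool" where
  "variety X \<longleftrightarrow> prevariety X \<and>
     closedin (top_of (variety_product X X)) ((\<lambda>x. (x, x)) ` topspace (top_of X))"

subsection \<open>Dimension\<close>

definition irreducible_closed :: "'a topology \<Rightarrow> 'a set \<Rightarrow> bool" where
  "irreducible_closed T Z \<longleftrightarrow> closedin T Z \<and> Z \<noteq> {} \<and>
     (\<forall>A B. closedin T A \<and> closedin T B \<and> Z = A \<union> B \<longrightarrow> Z = A \<or> Z = B)"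

text \<open>For varieties and their closed subsets the lengths of chains are bounded, so the supremum in
  \<^typ>\<open>nat\<close> is a maximum.\<close>

definition krull_dim :: "'a topology \<Rightarrow> nat" where
  "krull_dim T = Sup {n. \<exists>Z :: nat \<Rightarrow> 'a set.
     (\<forall>i\<le>n. irreducible_closed T (Z i)) \<and> (\<forall>i<n. Z i \<subset> Z (Suc i))}"

definition dimension :: "'a function_space \<Rightarrow> 'a set \<Rightarrow> nat" where
  "dimension X K = krull_dim (subtopology (top_of X) K)"

section \<open>Commutative algebraic groups\<close>

locale comm_algebraic_group = comm_group G
  for G :: "('a, 'b) monoid_scheme" (structure) and X :: "'a function_space" +
  assumes variety: "variety X"
    and carrier_eq: "topspace (top_of X) = carrier G"
    and mult_morphism: "morphism (variety_product X X) X (\<lambda>(x, y). x \<otimes> y)"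
    and inv_morphism: "morphism X X (\<lambda>x. inv x)"

definition connected_algebraic_subgroup ::
  "('a, 'b) monoid_scheme \<Rightarrow> 'a function_space \<Rightarrow> 'a set \<Rightarrow> bool" where
  "connected_algebraic_subgroup G X K \<longleftrightarrow>
     subgroup K G \<and> closedin (top_of X) K \<and> connectedin (top_of X) K"

section \<open>Ranks and the associated chain\<close>

definition int_independent :: "('a, 'b) monoid_scheme \<Rightarrow> 'a set \<Rightarrow> bool" where
  "int_independent G B \<longleftrightarrow>
     (\<forall>c :: 'a \<Rightarrow> int. finprod G (\<lambda>b. b [^]\<^bsub>G\<^esub> c b) B = \<one>\<^bsub>G\<^esub> \<longrightarrow> (\<forall>b\<in>B. c b = 0))"

definition ab_rank :: "('a, 'b) monoid_scheme \<Rightarrow> 'a set \<Rightarrow> nat" where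
  "ab_rank G A = Sup {card B | B. finite B \<and> B \<subseteq> A \<and> int_independent G B}"

definition Gam :: "('a, 'b) monoid_scheme \<Rightarrow> (nat \<Rightarrow> 'a) \<Rightarrow> nat \<Rightarrow> 'a set" where
  "Gam G \<gamma> j = generate G (\<gamma> ` {1..j})"

definition phi ::
  "('a, 'b) monoid_scheme \<Rightarrow> nat \<Rightarrow> (nat \<Rightarrow> 'a) \<Rightarrow> (nat \<Rightarrow> real) \<Rightarrow> 'a set \<Rightarrow> real" where
  "phi G l \<gamma> S K =
     (\<Sum>j=1..l. (real (ab_rank G (Gam G \<gamma> j \<inter> K)) - real (ab_rank G (Gam G \<gamma> (j - 1) \<inter> K))) * ln (S j))"

definition slope ::
  "('a, 'b) monoid_scheme \<Rightarrow> 'a function_space \<Rightarrow> nat \<Rightarrow> (nat \<Rightarrow> 'a) \<Rightarrow> (nat \<Rightarrow> real)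
     \<Rightarrow> 'a set \<Rightarrow> 'a set \<Rightarrow> real" where
  "slope G X l \<gamma> S H K =
     (phi G l \<gamma> S K - phi G l \<gamma> S H) / (real (dimension X K) - real (dimension X H))"

definition associated_chain ::
  "('a, 'b) monoid_scheme \<Rightarrow> 'a function_space \<Rightarrow> nat \<Rightarrow> (nat \<Rightarrow> 'a) \<Rightarrow> (nat \<Rightarrow> real)
     \<Rightarrow> nat \<Rightarrow> (nat \<Rightarrow> 'a set) \<Rightarrow> bool" where
  "associated_chain G X l \<gamma> S r H \<longleftrightarrow>
     1 \<le> r \<and> H 0 = {\<one>\<^bsub>G\<^esub>} \<and> H r = carrier G \<and>
     (\<forall>i\<le>r. connected_algebraic_subgroup G X (H i)) \<and>
     (\<forall>i<r. H i \<subset> H (i + 1)) \<and>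
     (\<forall>i<r. \<forall>K. connected_algebraic_subgroup G X K \<and> dimension X (H i) < dimension X K \<longrightarrow>
        slope G X l \<gamma> S (H i) K \<le> slope G X l \<gamma> S (H i) (H (i + 1)) \<and>
        (slope G X l \<gamma> S (H i) K = slope G X l \<gamma> S (H i) (H (i + 1)) \<longrightarrow>
           H i \<subseteq> K \<and> K \<subseteq> H (i + 1)))"

end

theory Submission
  imports Defs "HOL-Library.Function_Algebras"
begin

text \<open>
  If \<open>dim (H i)\<close> is strictly increasing in \<open>i\<close>, then \<open>K = H (i + 1)\<close> is admissible in the condition that
  defines \<open>H i\<close> from \<open>H (i - 1)\<close>. It is not contained in \<open>H i\<close>, so the
  slope from \<open>H (i - 1)\<close> to \<open>H (i + 1)\<close> is strictly smaller than the one from \<open>H (i - 1)\<close> to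
  \<open>H i\<close>, and the claim is the mediant inequality.

  The dimension increases strictly because a connected algebraic subgroup is irreducible and the
  lengths of chains of irreducible closed subsets are bounded. Irreducibility follows from
  homogeneity, as there are only finitely many irreducible components (Hilbert's basis theorem). A
  chain in affine \<open>n\<close>-space of length \<open>m\<close> gives rise to \<open>m\<close> algebraically independent polynomials, so
  \<open>m \<le> n\<close> by counting monomials.
\<close>

section \<open>Hilbert's basis theorem\<close>

text \<open>The slope divides by a difference of dimensions, and a dimension is a \<open>Sup\<close>
  of natural numbers, which carries no information when the set of chain lengths is unbounded. So a
  bound on all chains in \<open>X\<close> has to precede any comparison of dimensions. Homogeneity
  rests on the continuity of translations, which is not formal: the product of varieties has a finer
  topology than the topological product. The map from x to (a, x) is shown to be continuous through
  the fact that regular functions have open nonvanishing loci, and this fact is read off in affine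
  charts. The counting argument stands in for the theory of transcendence degree. Products of n + 1
  polynomials with exponents up to N number (N + 1)^(n + 1), whereas their degrees grow only
  linearly in N, so that they lie in a space spanned by O(N^n) monomials. For large N this forces a
  linear relation between the products.\<close>

definition subring_set :: "'c::comm_ring_1 set \<Rightarrow> bool" where
  "subring_set R \<longleftrightarrow> 0 \<in> R \<and> 1 \<in> R \<and> (\<forall>a\<in>R. \<forall>b\<in>R. a + b \<in> R \<and> a * b \<in> R) \<and> (\<forall>a\<in>R. - a \<in> R)"

lemma subring_setD:
  assumes "subring_set R"
  shows "0 \<in> R" "1 \<in> R" "a \<in> R \<Longrightarrow> b \<in> R \<Longrightarrow> a + b \<in> R" "a \<in> R \<Longrightarrow> b \<in> R \<Longrightarrow> a * b \<in> R"
    "a \<in> R \<Longrightarrow> - a \<in> R"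
  using assms by (auto simp: subring_set_def)

lemma subring_set_power: "subring_set R \<Longrightarrow> a \<in> R \<Longrightarrow> a ^ k \<in> R"
  by (induction k) (auto simp: subring_setD)

text \<open>Rings are subsets of one ambient type because all \<open>poly_funs n\<close> live in the
  same function type. The set is the \<open>R\<close>-span of \<open>F\<close>; it is an ideal when
  \<open>R\<close> is a subring containing \<open>F\<close>.\<close>

inductive_set ideal_gen :: "'c::comm_ring_1 set \<Rightarrow> 'c set \<Rightarrow> 'c set" for R F where
  zero: "0 \<in> ideal_gen R F"
| step: "a \<in> ideal_gen R F \<Longrightarrow> r \<in> R \<Longrightarrow> f \<in> F \<Longrightarrow> a + r * f \<in> ideal_gen R F"

lemma ideal_gen_mono: "F \<subseteq> F' \<Longrightarrow> ideal_gen R F \<subseteq> ideal_gen R F'"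
proof
  fix x assume "F \<subseteq> F'" "x \<in> ideal_gen R F"
  from this(2,1) show "x \<in> ideal_gen R F'"
    by induction (auto intro: ideal_gen.intros)
qed

lemma ideal_gen_base: "1 \<in> R \<Longrightarrow> f \<in> F \<Longrightarrow> f \<in> ideal_gen R F"
  using ideal_gen.step[OF ideal_gen.zero, of 1 R f F] by simp

lemma ideal_gen_add:
  assumes "a \<in> ideal_gen R F" "b \<in> ideal_gen R F"
  shows "a + b \<in> ideal_gen R F"
  using assms(2,1) by induction (auto simp: add.assoc[symmetric] intro: ideal_gen.intros)

lemma ideal_gen_mult:
  assumes "subring_set R" "r \<in> R" "a \<in> ideal_gen R F"
  shows "r * a \<in> ideal_gen R F"
  using assms(3)
proof induction
  case (step a s f)
  have "r * a + (r * s) * f \<in> ideal_gen R F"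
    using step subring_setD(4)[OF assms(1)] assms(2) by (intro ideal_gen.step)
  then show ?case by (simp add: algebra_simps)
qed (simp add: ideal_gen.zero)

lemma ideal_gen_minus:
  assumes "subring_set R" "a \<in> ideal_gen R F"
  shows "- a \<in> ideal_gen R F"
  using ideal_gen_mult[OF assms(1) _ assms(2), of "- 1"] assms(1) by (simp add: subring_setD)

lemma ideal_gen_subset:
  assumes "subring_set R" "F \<subseteq> ideal_gen R F'"
  shows "ideal_gen R F \<subseteq> ideal_gen R F'"
proof
  fix x assume "x \<in> ideal_gen R F"
  then show "x \<in> ideal_gen R F'"
    by induction (use assms in \<open>auto intro: ideal_gen.zero ideal_gen_add ideal_gen_mult\<close>)
qed

lemma ideal_gen_subset_ring:
  assumes "subring_set R" "F \<subseteq> R"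
  shows "ideal_gen R F \<subseteq> R"
proof
  fix x assume "x \<in> ideal_gen R F"
  then show "x \<in> R"
    by induction (use assms in \<open>auto simp: subring_setD\<close>)
qed

lemma ideal_gen_finite_prefix:
  "a \<in> ideal_gen R (range s) \<Longrightarrow> \<exists>N::nat. a \<in> ideal_gen R (s ` {..<N})"
proof (induction rule: ideal_gen.induct)
  case zero
  show ?case by (auto intro: ideal_gen.zero)
next
  case (step a r f)
  then obtain N k where N: "a \<in> ideal_gen R (s ` {..<N})" and k: "f = s k" by auto
  have "a \<in> ideal_gen R (s ` {..<max N (Suc k)})"
  proof -
    have "s ` {..<N} \<subseteq> s ` {..<max N (Suc k)}" by auto
    from ideal_gen_mono[OF this, of R] N show ?thesis by (rule subsetD)
  qed
  then show ?case
    using step k by (auto intro!: exI[of _ "max N (Suc k)"] ideal_gen.step)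
qed

definition noetherian_set :: "'c::comm_ring_1 set \<Rightarrow> bool" where
  "noetherian_set R \<longleftrightarrow> (\<forall>I. I \<subseteq> R \<and> ideal_gen R I \<subseteq> I \<longrightarrow> (\<exists>F. finite F \<and> F \<subseteq> I \<and> I \<subseteq> ideal_gen R F))"

text \<open>The ideal of all terms has finitely many generators, and each of them involves only
  finitely many terms, so a prefix of the sequence generates it. This is the form of the chain
  condition applied to leading coefficients.\<close>

lemma noetherian_set_sequence:
  assumes R: "subring_set R" and N: "noetherian_set R" and s: "range (s :: nat \<Rightarrow> _) \<subseteq> R"
  shows "\<exists>N. s N \<in> ideal_gen R (s ` {..<N})"
proof -
  let ?I = "ideal_gen R (range s)"
  have "?I \<subseteq> R" "ideal_gen R ?I \<subseteq> ?I"
    by (rule ideal_gen_subset_ring[OF R s], rule ideal_gen_subset[OF R order_refl])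
  then obtain F where F: "finite F" "F \<subseteq> ?I" "?I \<subseteq> ideal_gen R F"
    using N unfolding noetherian_set_def by (elim allE[of _ ?I]) auto
  have "\<exists>N. F \<subseteq> ideal_gen R (s ` {..<N::nat})"
    using F(1,2)
  proof (induction rule: finite_induct)
    case (insert f F)
    then obtain M M' where "F \<subseteq> ideal_gen R (s ` {..<M})" "f \<in> ideal_gen R (s ` {..<M'})"
      using ideal_gen_finite_prefix[of f R s] by auto
    moreover have "s ` {..<M} \<subseteq> s ` {..<max M M'}" "s ` {..<M'} \<subseteq> s ` {..<max M M'}" by auto
    ultimately show ?case
      using ideal_gen_mono[of _ "s ` {..<max M M'}" R] by (intro exI[of _ "max M M'"]) blast
  qed auto
  then obtain N where "F \<subseteq> ideal_gen R (s ` {..<N})" by blast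
  moreover have "s N \<in> ?I" using R by (intro ideal_gen_base) (auto simp: subring_setD)
  ultimately show ?thesis
    using F(3) ideal_gen_subset[OF R] by blast
qed

text \<open>Since \<open>t\<close> need not be transcendental over \<open>R\<close>, the coefficients are not unique.\<close>

primrec polys_below :: "'c::comm_ring_1 set \<Rightarrow> 'c \<Rightarrow> nat \<Rightarrow> 'c set" where
  "polys_below R t 0 = {0}"
| "polys_below R t (Suc d) = {p + a * t ^ d | p a. p \<in> polys_below R t d \<and> a \<in> R}"

definition adjoin :: "'c::comm_ring_1 set \<Rightarrow> 'c \<Rightarrow> 'c set" where
  "adjoin R t = (\<Union>d. polys_below R t d)"

context
  fixes R :: "'c::comm_ring_1 set" and t :: 'c
  assumes R: "subring_set R"
begin

lemma polys_below_SucI: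
  "p \<in> polys_below R t d \<Longrightarrow> a \<in> R \<Longrightarrow> p + a * t ^ d \<in> polys_below R t (Suc d)"
  by auto

lemma polys_below_Suc: "polys_below R t d \<subseteq> polys_below R t (Suc d)"
  using subring_setD(1)[OF R] by force

lemma polys_below_mono: "d \<le> e \<Longrightarrow> polys_below R t d \<subseteq> polys_below R t e"
  by (rule lift_Suc_mono_le[of "polys_below R t"]) (use polys_below_Suc in auto)

lemma zero_in_polys_below: "0 \<in> polys_below R t d"
  using polys_below_mono[of 0 d] by auto

lemma polys_below_add:
  "p \<in> polys_below R t d \<Longrightarrow> q \<in> polys_below R t d \<Longrightarrow> p + q \<in> polys_below R t d"
proof (induction d arbitrary: p q)
  case (Suc d)
  then obtain p' a q' b where "p = p' + a * t ^ d" "q = q' + b * t ^ d"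
    "p' \<in> polys_below R t d" "q' \<in> polys_below R t d" "a \<in> R" "b \<in> R" by auto
  note * = this
  then have eq: "p + q = (p' + q') + (a + b) * t ^ d" by (simp add: algebra_simps)
  show ?case
    unfolding eq using * by (intro polys_below_SucI Suc.IH subring_setD(3)[OF R])
qed auto

lemma polys_below_scale: "r \<in> R \<Longrightarrow> p \<in> polys_below R t d \<Longrightarrow> r * p \<in> polys_below R t d"
proof (induction d arbitrary: p)
  case (Suc d)
  then obtain p' a where "p = p' + a * t ^ d" "p' \<in> polys_below R t d" "a \<in> R" by auto
  note * = this
  then have eq: "r * p = r * p' + (r * a) * t ^ d" by (simp add: algebra_simps)
  show ?case
    unfolding eq using * Suc.prems(1) by (intro polys_below_SucI Suc.IH subring_setD(4)[OF R])
qed auto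

lemma polys_below_shift: "p \<in> polys_below R t d \<Longrightarrow> t ^ e * p \<in> polys_below R t (d + e)"
proof (induction d arbitrary: p)
  case 0
  then show ?case using zero_in_polys_below[of e] by simp
next
  case (Suc d)
  then obtain p' a where "p = p' + a * t ^ d" "p' \<in> polys_below R t d" "a \<in> R" by auto
  moreover from this have "t ^ e * p = t ^ e * p' + a * t ^ (d + e)"
    by (simp add: algebra_simps power_add)
  ultimately show ?case
    using polys_below_SucI[OF Suc.IH[of p'], of a] by simp
qed

lemma polys_below_uminus: "p \<in> polys_below R t d \<Longrightarrow> - p \<in> polys_below R t d"
  using polys_below_scale[of "- 1" p d] subring_setD(2,5)[OF R] by auto

lemma adjoin_add: "p \<in> adjoin R t \<Longrightarrow> q \<in> adjoin R t \<Longrightarrow> p + q \<in> adjoin R t"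
proof -
  assume "p \<in> adjoin R t" "q \<in> adjoin R t"
  then obtain d e where "p \<in> polys_below R t d" "q \<in> polys_below R t e"
    unfolding adjoin_def by auto
  then have "p \<in> polys_below R t (max d e)" "q \<in> polys_below R t (max d e)"
    using polys_below_mono[of d "max d e"] polys_below_mono[of e "max d e"] by auto
  then show ?thesis unfolding adjoin_def using polys_below_add by blast
qed

lemma adjoin_base: "a \<in> R \<Longrightarrow> a \<in> adjoin R t"
  unfolding adjoin_def by (auto intro!: exI[of _ "Suc 0"])

lemma adjoin_self: "t \<in> adjoin R t"
proof -
  have "0 + 1 * t ^ Suc 0 \<in> polys_below R t (Suc (Suc 0))"
    by (rule polys_below_SucI[OF zero_in_polys_below subring_setD(2)[OF R]])
  then have "t \<in> polys_below R t (Suc (Suc 0))" by (simp del: polys_below.simps)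
  then show ?thesis unfolding adjoin_def by blast
qed

lemma adjoin_mult:
  assumes "p \<in> adjoin R t" "q \<in> adjoin R t"
  shows "p * q \<in> adjoin R t"
proof -
  obtain d e where p: "p \<in> polys_below R t d" and q: "q \<in> polys_below R t e"
    using assms unfolding adjoin_def by auto
  show ?thesis
    using q
  proof (induction e arbitrary: q)
    case 0
    then show ?case using adjoin_base[of 0] subring_setD(1)[OF R] by simp
  next
    case (Suc e)
    then obtain q' a where q': "q = q' + a * t ^ e" "q' \<in> polys_below R t e" "a \<in> R" by auto
    then have "p * q = p * q' + a * (t ^ e * p)" by (simp add: algebra_simps)
    moreover have "a * (t ^ e * p) \<in> adjoin R t"
      unfolding adjoin_def using polys_below_scale[OF q'(3) polys_below_shift[OF p, of e]] by auto
    ultimately show ?case using adjoin_add Suc.IH q' by auto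
  qed
qed

lemma subring_set_adjoin: "subring_set (adjoin R t)"
proof -
  have "- p \<in> adjoin R t" if "p \<in> adjoin R t" for p
    using that polys_below_uminus unfolding adjoin_def by blast
  then show ?thesis
    unfolding subring_set_def
    using adjoin_add adjoin_mult adjoin_base subring_setD(1,2)[OF R] by simp
qed

text \<open>Choose the \<open>f k\<close> successively of minimal degree outside the ideal generated so far. By
  noetherianity of \<open>R\<close>, some leading coefficient is a combination of the previous ones, which allows
  the degree of the corresponding \<open>f N\<close> to be lowered.\<close>

theorem noetherian_set_adjoin:
  assumes N: "noetherian_set R"
  shows "noetherian_set (adjoin R t)"
  unfolding noetherian_set_def
proof (intro allI impI, rule ccontr)
  let ?Q = "adjoin R t"
  fix I assume I: "I \<subseteq> ?Q \<and> ideal_gen ?Q I \<subseteq> I"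
    and nfg: "\<not> (\<exists>F. finite F \<and> F \<subseteq> I \<and> I \<subseteq> ideal_gen ?Q F)"
  note Q = subring_set_adjoin
  \<comment> \<open>For elements of \<open>adjoin R t\<close> this is one more than the least degree
    of a representation, with 0 reserved for the zero element.\<close>
  define deg where "deg g = (LEAST d. g \<in> polys_below R t d)" for g
  have deg: "g \<in> polys_below R t (deg g)" if "g \<in> I" for g
  proof -
    have "\<exists>d. g \<in> polys_below R t d" using that I by (auto simp: adjoin_def)
    then show ?thesis unfolding deg_def by (rule LeastI_ex)
  qed
  let ?C = "\<lambda>f k. I - ideal_gen ?Q (f ` {..<k})"
  \<comment> \<open>Each choice depends on all earlier ones; it is possible because no finite subset
    of \<open>I\<close> generates \<open>I\<close>.\<close>
  have "\<exists>f. \<forall>k::nat. f k \<in> ?C f k \<and> (\<forall>g\<in>?C f k. deg (f k) \<le> deg g)"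
  proof (rule dependent_wellorder_choice)
    fix r and f g :: "nat \<Rightarrow> 'c" and k :: nat
    assume "\<And>y. y < k \<Longrightarrow> f y = g y"
    then have "f ` {..<k} = g ` {..<k}" by auto
    then show "(r \<in> ?C f k \<and> (\<forall>h\<in>?C f k. deg r \<le> deg h))
        = (r \<in> ?C g k \<and> (\<forall>h\<in>?C g k. deg r \<le> deg h))" by simp
  next
    fix k :: nat and f
    assume "\<And>y. y < k \<Longrightarrow> f y \<in> ?C f y \<and> (\<forall>g\<in>?C f y. deg (f y) \<le> deg g)"
    then have "f ` {..<k} \<subseteq> I" by auto
    then have "?C f k \<noteq> {}" using nfg by blast
    then show "\<exists>r. r \<in> ?C f k \<and> (\<forall>g\<in>?C f k. deg r \<le> deg g)"
      using ex_has_least_nat[of "\<lambda>g. g \<in> ?C f k" _ deg] by blast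
  qed
  then obtain f where fC: "\<forall>k::nat. f k \<in> ?C f k \<and> (\<forall>g\<in>?C f k. deg (f k) \<le> deg g)" ..
  have f: "f k \<in> ?C f k" for k using fC[rule_format, of k] by (rule conjunct1)
  have f_min: "deg (f k) \<le> deg g" if "g \<in> ?C f k" for k g
    using fC[rule_format, of k, THEN conjunct2] that by (rule bspec)
  \<comment> \<open>The value 0 would make \<open>f k\<close> zero and put it in the ideal of its
    predecessors, so there is a leading term to split off.\<close>
  have "\<exists>e p b. deg (f k) = Suc e \<and> p \<in> polys_below R t e \<and> b \<in> R \<and> f k = p + b * t ^ e" for k
  proof (cases "deg (f k)")
    case 0
    then show ?thesis using deg[of "f k"] f[of k] ideal_gen.zero[of ?Q "f ` {..<k}"] by auto
  next
    case (Suc e)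
    then show ?thesis using deg[of "f k"] f[of k] by auto
  qed
  then obtain e p b where e: "\<And>k. deg (f k) = Suc (e k)" and p: "\<And>k. p k \<in> polys_below R t (e k)"
    and b: "\<And>k. b k \<in> R" and fk: "\<And>k. f k = p k + b k * t ^ e k"
    by metis
  obtain n where n: "b n \<in> ideal_gen R (b ` {..<n})"
    using noetherian_set_sequence[OF R N, of b] b by blast
  have e_mono: "e i \<le> e n" if "i < n" for i
  proof -
    have "ideal_gen ?Q (f ` {..<i}) \<subseteq> ideal_gen ?Q (f ` {..<n})"
      using that by (intro ideal_gen_mono) auto
    then have "f n \<in> ?C f i" using f[of n] by auto
    then show ?thesis using f_min[of "f n" i] e by simp
  qed
  \<comment> \<open>A combination \<beta> of earlier leading coefficients lifts to the ideal of the
    earlier \<open>f i\<close>, up to terms below degree \<open>e n\<close>: each \<open>f i\<close>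
    is multiplied by \<open>t ^ (e n - e i)\<close>, a subtraction that \<open>e_mono\<close> keeps
    from truncating.\<close>
  have "\<exists>h \<in> ideal_gen ?Q (f ` {..<n}). h - \<beta> * t ^ e n \<in> polys_below R t (e n)"
    if "\<beta> \<in> ideal_gen R (b ` {..<n})" for \<beta>
    using that
  proof induction
    case zero
    then show ?case
      using ideal_gen.zero zero_in_polys_below by (intro bexI[of _ 0]) auto
  next
    case (step a r c)
    then obtain h i where h: "h \<in> ideal_gen ?Q (f ` {..<n})" "h - a * t ^ e n \<in> polys_below R t (e n)"
      and i: "i < n" "c = b i" by auto
    let ?s = "r * t ^ (e n - e i)"
    have "?s \<in> ?Q"
      using step(2) by (intro adjoin_mult adjoin_base subring_set_power[OF Q] adjoin_self)
    then have hs: "h + ?s * f i \<in> ideal_gen ?Q (f ` {..<n})"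
      using h(1) i by (intro ideal_gen.step) auto
    have eq: "h + ?s * f i - (a + r * c) * t ^ e n
        = (h - a * t ^ e n) + r * (t ^ (e n - e i) * p i)"
      using e_mono[OF i(1)] by (simp add: fk i(2) algebra_simps flip: power_add)
    have "t ^ (e n - e i) * p i \<in> polys_below R t (e n)"
      using polys_below_shift[OF p, of "e n - e i" i] e_mono[OF i(1)] by simp
    then have "h + ?s * f i - (a + r * c) * t ^ e n \<in> polys_below R t (e n)"
      unfolding eq by (intro polys_below_add polys_below_scale[OF step(2)] h(2))
    with hs show ?case by blast
  qed
  from this[OF n] obtain h where h: "h \<in> ideal_gen ?Q (f ` {..<n})"
    "h - b n * t ^ e n \<in> polys_below R t (e n)" by auto
  \<comment> \<open>Subtracting the lift removes the leading term but does not lead into the ideal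
    of the predecessors, against the minimality of \<open>deg (f n)\<close>.\<close>
  let ?g = "f n + - h"
  have "f ` {..<n} \<subseteq> I" using f by auto
  then have "h \<in> ideal_gen ?Q I" using h(1) ideal_gen_mono[of "f ` {..<n}" I ?Q] by blast
  then have "- h \<in> ideal_gen ?Q I" using ideal_gen_minus[OF Q] by blast
  moreover have "f n \<in> ideal_gen ?Q I" using f[of n] subring_setD(2)[OF Q] by (intro ideal_gen_base) auto
  ultimately have "?g \<in> I" using I ideal_gen_add by blast
  moreover have "?g \<notin> ideal_gen ?Q (f ` {..<n})"
  proof
    assume "?g \<in> ideal_gen ?Q (f ` {..<n})"
    from ideal_gen_add[OF this h(1)] f[of n] show False by simp
  qed
  ultimately have "Suc (e n) \<le> deg ?g" using f_min[of ?g n] e[of n] by simp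
  moreover have "?g = p n + - (h - b n * t ^ e n)" by (simp add: fk)
  then have "?g \<in> polys_below R t (e n)"
    using polys_below_add[OF p polys_below_uminus[OF h(2)]] by (simp only:)
  then have "deg ?g \<le> e n" unfolding deg_def by (rule Least_le)
  ultimately show False by simp
qed

end

subsection \<open>Polynomial functions\<close>

lemma poly_funs_mono: "p \<in> poly_funs n \<Longrightarrow> n \<le> m \<Longrightarrow> p \<in> poly_funs m"
  by (induction rule: poly_funs.induct) (auto intro: poly_funs.intros)

lemma poly_funs_add': "p \<in> poly_funs n \<Longrightarrow> q \<in> poly_funs n \<Longrightarrow> p + q \<in> poly_funs n"
  using poly_funs.add[of p n q] by (simp add: plus_fun_def)

lemma poly_funs_mult': "p \<in> poly_funs n \<Longrightarrow> q \<in> poly_funs n \<Longrightarrow> p * q \<in> poly_funs n"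
  using poly_funs.mult[of p n q] by (simp add: times_fun_def)

lemma subring_set_poly_funs: "subring_set (poly_funs n)"
proof -
  have "- a \<in> poly_funs n" if "a \<in> poly_funs n" for a
    using poly_funs.mult[OF poly_funs.const[of "-1"] that] by (simp add: fun_Compl_def)
  then show ?thesis
    unfolding subring_set_def
    using poly_funs_add' poly_funs_mult' poly_funs.const[of 0 n] poly_funs.const[of 1 n]
    by (simp add: zero_fun_def one_fun_def)
qed

lemma poly_funs_sum:
  "(\<And>i. i \<in> A \<Longrightarrow> p i \<in> poly_funs n) \<Longrightarrow> (\<lambda>x. \<Sum>i\<in>A. p i x) \<in> poly_funs n"
  by (induction A rule: infinite_finite_induct) (auto intro: poly_funs.intros)

lemma poly_funs_prod:
  "(\<And>i. i \<in> A \<Longrightarrow> p i \<in> poly_funs n) \<Longrightarrow> (\<lambda>x. \<Prod>i\<in>A. p i x) \<in> poly_funs n"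
  by (induction A rule: infinite_finite_induct) (auto intro: poly_funs.intros)

lemma poly_funs_power: "p \<in> poly_funs n \<Longrightarrow> (\<lambda>x. p x ^ k) \<in> poly_funs n"
  by (induction k) (auto intro: poly_funs.intros)

text \<open>Turns one more variable into one more adjoined element, so that the basis theorem
  supplies the induction step on \<open>n\<close>.\<close>

lemma poly_funs_Suc: "poly_funs (Suc n) = adjoin (poly_funs n) (\<lambda>x. x n)"
proof
  note R = subring_set_poly_funs[of n]
  show "poly_funs (Suc n) \<subseteq> adjoin (poly_funs n) (\<lambda>x. x n)"
  proof
    fix p assume "p \<in> poly_funs (Suc n)"
    then show "p \<in> adjoin (poly_funs n) (\<lambda>x. x n)"
    proof induction
      case (const c)
      then show ?case by (intro adjoin_base[OF R] poly_funs.const)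
    next
      case (coord i)
      then show ?case
        using adjoin_self[OF R, of "\<lambda>x. x n"] adjoin_base[OF R] poly_funs.coord[of i n]
        by (cases "i = n") auto
    next
      case (add p q)
      then show ?case using adjoin_add[OF R, of p _ q] by (simp add: plus_fun_def)
    next
      case (mult p q)
      then show ?case using adjoin_mult[OF R, of p _ q] by (simp add: times_fun_def)
    qed
  qed
  have "polys_below (poly_funs n) (\<lambda>x. x n) d \<subseteq> poly_funs (Suc n)" for d
  proof (induction d)
    case 0
    then show ?case using subring_setD(1)[OF subring_set_poly_funs] by simp
  next
    case (Suc d)
    have "(\<lambda>x. x n) \<in> poly_funs (Suc n)" by (rule poly_funs.coord) simp
    then have "(\<lambda>x. x n) ^ d \<in> poly_funs (Suc n)"
      using subring_set_power[OF subring_set_poly_funs] by blast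
    then show ?case
      using Suc by (auto intro!: poly_funs_add' poly_funs_mult' intro: poly_funs_mono)
  qed
  then show "adjoin (poly_funs n) (\<lambda>x. x n) \<subseteq> poly_funs (Suc n)" unfolding adjoin_def by blast
qed

theorem noetherian_set_poly_funs: "noetherian_set (poly_funs n)"
proof (induction n)
  case 0
  \<comment> \<open>Polynomials in no variables form a field, where a nonzero ideal is generated by
    any of its nonzero elements.\<close>
  have const: "\<exists>c. p = (\<lambda>_. c)" if "p \<in> poly_funs 0" for p
    using that by induction auto
  show ?case
    unfolding noetherian_set_def
  proof (intro allI impI)
    fix I assume I: "I \<subseteq> poly_funs 0 \<and> ideal_gen (poly_funs 0) I \<subseteq> I"
    show "\<exists>F. finite F \<and> F \<subseteq> I \<and> I \<subseteq> ideal_gen (poly_funs 0) F"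
    proof (cases "I \<subseteq> {0}")
      case True
      then show ?thesis using ideal_gen.zero by (intro exI[of _ "{}"]) auto
    next
      case False
      then obtain f where f: "f \<in> I" "f \<noteq> 0" by auto
      then obtain c where c: "f = (\<lambda>_. c)" "c \<noteq> 0"
      proof -
        obtain c where "f = (\<lambda>_. c)" using const[of f] I f(1) by auto
        then show thesis using that f(2) by (auto simp: zero_fun_def)
      qed
      have "g \<in> ideal_gen (poly_funs 0) {f}" if g: "g \<in> I" for g
      proof -
        obtain d where d: "g = (\<lambda>_. d)" using const I g by blast
        have "0 + (\<lambda>_. d / c) * f \<in> ideal_gen (poly_funs 0) {f}"
          by (intro ideal_gen.intros poly_funs.const) auto
        moreover have "0 + (\<lambda>_. d / c) * f = g" using c d by (auto simp: fun_eq_iff)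
        ultimately show ?thesis by simp
      qed
      then show ?thesis using f by (intro exI[of _ "{f}"]) auto
    qed
  qed
next
  case (Suc n)
  then show ?case
    unfolding poly_funs_Suc by (intro noetherian_set_adjoin subring_set_poly_funs)
qed

section \<open>Noetherian spaces and chains of irreducible closed sets\<close>

definition noetherian_space :: "'a topology \<Rightarrow> bool" where
  "noetherian_space T \<longleftrightarrow>
     (\<forall>C :: nat \<Rightarrow> 'a set. (\<forall>k. closedin T (C k) \<and> C (Suc k) \<subseteq> C k) \<longrightarrow> (\<exists>N. \<forall>k\<ge>N. C k = C N))"

definition irreducible_chain :: "'a topology \<Rightarrow> nat \<Rightarrow> (nat \<Rightarrow> 'a set) \<Rightarrow> bool" where
  "irreducible_chain T m Z \<longleftrightarrow>
     (\<forall>i\<le>m. irreducible_closed T (Z i)) \<and> (\<forall>i<m. Z i \<subset> Z (Suc i))"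

lemma irreducible_chain_take: "irreducible_chain T m Z \<Longrightarrow> k \<le> m \<Longrightarrow> irreducible_chain T k Z"
  by (auto simp: irreducible_chain_def)

lemma irreducible_chain_mono: "irreducible_chain T m Z \<Longrightarrow> i \<le> m \<Longrightarrow> Z 0 \<subseteq> Z i"
proof (induction i)
  case (Suc i)
  then have "Z 0 \<subseteq> Z i" "Z i \<subset> Z (Suc i)" by (auto simp: irreducible_chain_def)
  then show ?case by blast
qed simp

lemma irreducible_closedD:
  assumes "irreducible_closed T Z"
  shows "closedin T Z" "Z \<noteq> {}"
    "closedin T A \<Longrightarrow> closedin T B \<Longrightarrow> Z = A \<union> B \<Longrightarrow> Z = A \<or> Z = B"
  using assms unfolding irreducible_closed_def by (fast, fast, fast)

lemma irreducible_closedI: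
  assumes "closedin T Z" "Z \<noteq> {}"
    and "\<And>A B. closedin T A \<Longrightarrow> closedin T B \<Longrightarrow> Z = A \<union> B \<Longrightarrow> Z = A \<or> Z = B"
  shows "irreducible_closed T Z"
  using assms unfolding irreducible_closed_def by fast

lemma irreducible_closed_subset_Un:
  assumes "irreducible_closed T Z" "closedin T A" "closedin T B" "Z \<subseteq> A \<union> B"
  shows "Z \<subseteq> A \<or> Z \<subseteq> B"
proof -
  have "closedin T (Z \<inter> A)" "closedin T (Z \<inter> B)"
    by (intro closedin_Int irreducible_closedD(1)[OF assms(1)] assms(2,3))+
  moreover have "Z = (Z \<inter> A) \<union> (Z \<inter> B)" using assms(4) by blast
  ultimately have "Z = Z \<inter> A \<or> Z = Z \<inter> B" by (rule irreducible_closedD(3)[OF assms(1)])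
  then show ?thesis by auto
qed

lemma irreducible_closed_subset_Union:
  assumes "irreducible_closed T Z" "finite \<F>" "\<And>A. A \<in> \<F> \<Longrightarrow> closedin T A" "Z \<subseteq> \<Union>\<F>"
  shows "\<exists>A\<in>\<F>. Z \<subseteq> A"
  using assms(2-)
proof (induction \<F> rule: finite_induct)
  case empty
  then show ?case using assms(1) by (auto simp: irreducible_closed_def)
next
  case (insert A \<F>)
  have "closedin T (\<Union>\<F>)" using insert by (intro closedin_Union) auto
  then have "Z \<subseteq> A \<or> Z \<subseteq> \<Union>\<F>"
    using irreducible_closed_subset_Un[OF assms(1), of A "\<Union>\<F>"] insert.prems by auto
  then show ?case using insert by auto
qed

lemma irreducible_closed_subtopology:
  assumes "closedin T K"
  shows "irreducible_closed (subtopology T K) Z \<longleftrightarrow> irreducible_closed T Z \<and> Z \<subseteq> K"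
proof -
  have cl: "closedin (subtopology T K) A \<longleftrightarrow> closedin T A \<and> A \<subseteq> K" for A
    by (rule closedin_closed_subtopology[OF assms])
  show ?thesis unfolding irreducible_closed_def cl by blast
qed

text \<open>Two closed sets covering the trace on \<open>U\<close> cover \<open>Z\<close> itself
  once the closed set \<open>Z - U\<close> is joined to one of them.\<close>

lemma irreducible_closed_Int_open:
  assumes Z: "irreducible_closed T Z" and U: "openin T U" "Z \<inter> U \<noteq> {}"
  shows "irreducible_closed (subtopology T U) (Z \<inter> U)"
  unfolding irreducible_closed_def
proof (intro conjI allI impI)
  show "closedin (subtopology T U) (Z \<inter> U)"
    using Z by (auto simp: irreducible_closed_def closedin_subtopology)
  show "Z \<inter> U \<noteq> {}" by (rule U(2))
next
  fix A B assume AB: "closedin (subtopology T U) A \<and> closedin (subtopology T U) B \<and> Z \<inter> U = A \<union> B"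
  then obtain A' B' where A': "closedin T A'" "A = A' \<inter> U" and B': "closedin T B'" "B = B' \<inter> U"
    by (auto simp: closedin_subtopology)
  have c: "closedin T (Z - U)" using Z U by (auto simp: irreducible_closed_def)
  have "Z \<subseteq> (A' \<union> (Z - U)) \<union> B'" using AB A' B' by auto
  then have "Z \<subseteq> A' \<union> (Z - U) \<or> Z \<subseteq> B'"
    by (intro irreducible_closed_subset_Un[OF Z] closedin_Un A' B' c)
  then show "Z \<inter> U = A \<or> Z \<inter> U = B" using AB A' B' by blast
qed

text \<open>Transfers chains to a chart. If two neighbours had the same trace on \<open>U\<close>,
  the larger one would be covered by the smaller one and the part outside \<open>U\<close>, both
  proper closed subsets.\<close>

lemma irreducible_chain_Int_open:
  assumes Z: "irreducible_chain T m Z" and U: "openin T U" "Z 0 \<inter> U \<noteq> {}"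
  shows "irreducible_chain (subtopology T U) m (\<lambda>i. Z i \<inter> U)"
  unfolding irreducible_chain_def
proof (intro conjI allI impI)
  fix i assume "i \<le> m"
  then show "irreducible_closed (subtopology T U) (Z i \<inter> U)"
    using irreducible_closed_Int_open[of T "Z i" U] Z U irreducible_chain_mono[OF Z, of i]
    by (auto simp: irreducible_chain_def)
next
  fix i assume i: "i < m"
  then have Zi: "irreducible_closed T (Z i)" "irreducible_closed T (Z (Suc i))" "Z i \<subset> Z (Suc i)"
    using Z by (auto simp: irreducible_chain_def)
  have ne: "Z (Suc i) \<inter> U \<noteq> {}" using irreducible_chain_mono[OF Z, of "Suc i"] i U by auto
  have "Z i \<inter> U \<noteq> Z (Suc i) \<inter> U"
  proof
    assume "Z i \<inter> U = Z (Suc i) \<inter> U"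
    then have "Z (Suc i) \<subseteq> Z i \<union> (Z (Suc i) - U)" by auto
    moreover have "closedin T (Z i)" "closedin T (Z (Suc i) - U)"
      using Zi U by (auto simp: irreducible_closed_def)
    ultimately have "Z (Suc i) \<subseteq> Z i \<or> Z (Suc i) \<subseteq> Z (Suc i) - U"
      using irreducible_closed_subset_Un[OF Zi(2)] by blast
    then show False using Zi(3) ne by auto
  qed
  then show "Z i \<inter> U \<subset> Z (Suc i) \<inter> U" using Zi(3) by auto
qed

lemma noetherian_space_closed_subtopology:
  "noetherian_space T \<Longrightarrow> closedin T K \<Longrightarrow> noetherian_space (subtopology T K)"
  unfolding noetherian_space_def by (simp add: closedin_closed_subtopology)

lemma noetherian_space_cover:
  assumes "finite \<U>" "\<Union>\<U> = topspace T" "\<And>U. U \<in> \<U> \<Longrightarrow> noetherian_space (subtopology T U)"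
  shows "noetherian_space T"
  unfolding noetherian_space_def
proof (intro allI impI)
  fix C :: "nat \<Rightarrow> 'a set" assume C: "\<forall>k. closedin T (C k) \<and> C (Suc k) \<subseteq> C k"
  have "\<exists>N. \<forall>k\<ge>N. C k \<inter> U = C N \<inter> U" if "U \<in> \<U>" for U
  proof -
    have "\<forall>k. closedin (subtopology T U) (C k \<inter> U) \<and> C (Suc k) \<inter> U \<subseteq> C k \<inter> U"
      using C by (auto simp: closedin_subtopology)
    then show ?thesis
      using assms(3)[OF that] unfolding noetherian_space_def
      by (elim allE[of _ "\<lambda>k. C k \<inter> U"]) auto
  qed
  then obtain N where N: "\<And>U k. U \<in> \<U> \<Longrightarrow> k \<ge> N U \<Longrightarrow> C k \<inter> U = C (N U) \<inter> U" by metis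
  \<comment> \<open>A threshold that serves all members of the cover; inserting 0 keeps
    \<open>Max\<close> meaningful for the empty cover.\<close>
  define M where "M = Max (insert 0 (N ` \<U>))"
  have M: "N U \<le> M" if "U \<in> \<U>" for U
    unfolding M_def using assms(1) that by (intro Max_ge) auto
  have "C k = C M" if "k \<ge> M" for k
  proof -
    have "C k \<inter> U = C M \<inter> U" if U: "U \<in> \<U>" for U
      using N[OF U, of k] N[OF U, of M] M[OF U] \<open>k \<ge> M\<close> by auto
    then have "C k \<inter> \<Union>\<U> = C M \<inter> \<Union>\<U>" by auto
    moreover have "C k \<subseteq> \<Union>\<U>" "C M \<subseteq> \<Union>\<U>" unfolding assms(2) using C closedin_subset by metis+
    ultimately show ?thesis by (simp add: Int_absorb2)
  qed
  then show "\<exists>N. \<forall>k\<ge>N. C k = C N" by blast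
qed

text \<open>Noetherian induction: a counterexample is nonempty and reducible, and one of its two
  proper closed pieces is again a counterexample. Iteration would give an infinite strictly
  descending sequence of closed sets.\<close>

lemma noetherian_space_finite_irreducible_cover:
  assumes T: "noetherian_space T" and C: "closedin T C"
  shows "\<exists>\<F>. finite \<F> \<and> (\<forall>A\<in>\<F>. irreducible_closed T A) \<and> \<Union>\<F> = C"
proof (rule ccontr)
  let ?P = "\<lambda>C. \<exists>\<F>. finite \<F> \<and> (\<forall>A\<in>\<F>. irreducible_closed T A) \<and> \<Union>\<F> = C"
  let ?Q = "\<lambda>C. closedin T C \<and> \<not> ?P C"
  assume "\<not> ?P C"
  have step: "\<exists>B. ?Q B \<and> B \<subset> A" if A: "?Q A" for A
  proof -
    have A_red: "\<not> irreducible_closed T A"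
    proof
      assume "irreducible_closed T A"
      then have "?P A" by (intro exI[of _ "{A}"]) auto
      then show False using A by blast
    qed
    have A_ne: "A \<noteq> {}"
    proof
      assume "A = {}"
      then have "?P A" by (intro exI[of _ "{}"]) auto
      then show False using A by blast
    qed
    have "\<exists>B B'. closedin T B \<and> closedin T B' \<and> A = B \<union> B' \<and> A \<noteq> B \<and> A \<noteq> B'"
    proof (rule ccontr)
      assume "\<not> ?thesis"
      then have "irreducible_closed T A"
        using A A_ne by (intro irreducible_closedI) fast+
      with A_red show False ..
    qed
    then obtain B B' where B: "closedin T B" "closedin T B'" "A = B \<union> B'" "A \<noteq> B" "A \<noteq> B'"
      by auto
    have "\<not> ?P B \<or> \<not> ?P B'"
    proof (rule ccontr)
      assume "\<not> (\<not> ?P B \<or> \<not> ?P B')"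
      then have "?P B" "?P B'" by (simp_all only: de_Morgan_disj not_not)
      then obtain \<F> \<F>' where "finite \<F>" "\<forall>A\<in>\<F>. irreducible_closed T A" "\<Union>\<F> = B"
        "finite \<F>'" "\<forall>A\<in>\<F>'. irreducible_closed T A" "\<Union>\<F>' = B'" by (elim exE conjE)
      then have "?P A" using B(3) by (intro exI[of _ "\<F> \<union> \<F>'"]) auto
      then show False using A by blast
    qed
    then show ?thesis using B by blast
  qed
  have "\<exists>f. \<forall>k::nat. ?Q (f k) \<and> f (Suc k) \<subset> f k"
  proof (rule dependent_nat_choice)
    show "\<exists>A. ?Q A" using C \<open>\<not> ?P C\<close> by (intro exI conjI)
  qed (rule step)
  then obtain f where f: "\<forall>k::nat. ?Q (f k) \<and> f (Suc k) \<subset> f k" ..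
  then have f: "closedin T (f k)" "f (Suc k) \<subset> f k" for k
    using spec[OF f, of k] by (auto simp only:)
  have "\<forall>k. closedin T (f k) \<and> f (Suc k) \<subseteq> f k"
    by (intro allI conjI f(1) psubset_imp_subset[OF f(2)])
  then have "\<exists>N. \<forall>k\<ge>N. f k = f N" by (rule T[unfolded noetherian_space_def, THEN spec, THEN mp])
  then obtain N where "\<forall>k\<ge>N. f k = f N" ..
  then have "f (Suc N) = f N" by (elim allE[of _ "Suc N"] impE) simp_all
  moreover have "f (Suc N) \<noteq> f N" using f(2)[of N] by blast
  ultimately show False by contradiction
qed

section \<open>Homeomorphisms and homogeneous spaces\<close>

lemma homeomorphic_maps_image:
  assumes "homeomorphic_maps T T' f g" "A \<subseteq> topspace T"
  shows "g ` f ` A = A"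
proof -
  have "g (f x) = x" if "x \<in> A" for x using assms that by (auto simp: homeomorphic_maps_def)
  then show ?thesis by (simp add: image_image)
qed

lemma homeomorphic_maps_irreducible_closed:
  assumes fg: "homeomorphic_maps T T' f g" and Z: "irreducible_closed T Z"
  shows "irreducible_closed T' (f ` Z)"
proof (rule irreducible_closedI)
  have gf: "homeomorphic_maps T' T g f" by (rule homeomorphic_maps_sym[THEN iffD1, OF fg])
  have f: "homeomorphic_map T T' f" and g: "homeomorphic_map T' T g"
    using fg homeomorphic_maps_map by blast+
  note Z_cl = irreducible_closedD(1)[OF Z]
  show "closedin T' (f ` Z)"
    using homeomorphic_map_closedness_eq[OF f] Z_cl closedin_subset[OF Z_cl] by blast
  show "f ` Z \<noteq> {}" using irreducible_closedD(2)[OF Z] by simp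
  fix A B assume A: "closedin T' A" and B: "closedin T' B" and AB: "f ` Z = A \<union> B"
  have "Z = g ` A \<union> g ` B"
    using homeomorphic_maps_image[OF fg closedin_subset[OF Z_cl]] AB by (simp add: image_Un)
  moreover have "closedin T (g ` A)" "closedin T (g ` B)"
    using homeomorphic_map_closedness_eq[OF g] A B closedin_subset by blast+
  ultimately have "Z = g ` A \<or> Z = g ` B" using irreducible_closedD(3)[OF Z] by blast
  then show "f ` Z = A \<or> f ` Z = B"
    using homeomorphic_maps_image[OF gf closedin_subset[OF A]]
      homeomorphic_maps_image[OF gf closedin_subset[OF B]] by auto
qed

text \<open>Each point of a homogeneous Noetherian space lies on only one irreducible component, so that
  the components are disjoint.\<close>

lemma irreducible_of_homogeneous:
  assumes T: "noetherian_space T" "connected_space T" "topspace T \<noteq> {}"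
    and hom: "\<And>x y. x \<in> topspace T \<Longrightarrow> y \<in> topspace T \<Longrightarrow> \<exists>f g. homeomorphic_maps T T f g \<and> f x = y"
  shows "irreducible_closed T (topspace T)"
proof -
  let ?P = "\<lambda>\<F>. finite \<F> \<and> (\<forall>A\<in>\<F>. irreducible_closed T A) \<and> \<Union>\<F> = topspace T"
  obtain \<F>0 where "?P \<F>0"
    using noetherian_space_finite_irreducible_cover[OF T(1) closedin_topspace] by blast
  \<comment> \<open>A cover with the fewest members is irredundant, so its members play the part of
    the irreducible components.\<close>
  from ex_has_least_nat[of ?P, OF this, of card]
  obtain \<F> where "?P \<F> \<and> (\<forall>\<F>'. ?P \<F>' \<longrightarrow> card \<F> \<le> card \<F>')" ..
  note * = this
  have F: "?P \<F>" using * by (rule conjunct1)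
  have F_min: "card \<F> \<le> card \<F>'" if "?P \<F>'" for \<F>'
    using *[THEN conjunct2, THEN spec] that by (rule mp)
  have cl: "closedin T A" if "A \<in> \<F>" for A using F that by (auto simp: irreducible_closed_def)
  have irredundant: "\<not> A \<subseteq> \<Union>(\<F> - {A})" if A: "A \<in> \<F>" for A
  proof
    assume "A \<subseteq> \<Union>(\<F> - {A})"
    then have "\<Union>(\<F> - {A}) = \<Union>\<F>" using A by blast
    then have "?P (\<F> - {A})" using F by auto
    from F_min[OF this] show False using F card_Diff1_less[of \<F> A] A by auto
  qed
  have into: "\<exists>A\<in>\<F>. Z \<subseteq> A" if "irreducible_closed T Z" for Z
    using irreducible_closed_subset_Union[OF that, of \<F>] F cl that closedin_subset
    by (metis irreducible_closed_def)
  have "\<F> \<noteq> {}"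
  proof
    assume "\<F> = {}"
    then have "topspace T = {}" using F by (simp only: Union_empty)
    with T(3) show False ..
  qed
  then obtain A where A: "A \<in> \<F>" by blast
  \<comment> \<open>One point that lies on \<open>A\<close> alone suffices, since homogeneity
    carries the property to all points.\<close>
  obtain q where q: "q \<in> A" "q \<notin> \<Union>(\<F> - {A})" using irredundant[OF A] by blast
  have qT: "q \<in> topspace T" using q(1) A F by auto
  have disj: "B = C" if B: "B \<in> \<F>" "C \<in> \<F>" "x \<in> B" "x \<in> C" for B C x
  proof -
    have xT: "x \<in> topspace T" using B F by auto
    obtain f g where fg: "homeomorphic_maps T T f g" and fx: "f x = q" using hom[OF xT qT] by blast
    have gf: "homeomorphic_maps T T g f" by (rule homeomorphic_maps_sym[THEN iffD1, OF fg])
    \<comment> \<open>A homeomorphism taking \<open>x\<close> to \<open>q\<close> carries each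
      member through \<open>x\<close> into a member through \<open>q\<close>, which can only be
      \<open>A\<close>.\<close>
    have *: "D \<subseteq> g ` A" if D: "D \<in> \<F>" "x \<in> D" for D
    proof -
      obtain E where E: "E \<in> \<F>" "f ` D \<subseteq> E"
        using into[OF homeomorphic_maps_irreducible_closed[OF fg]] D F by blast
      then have "q \<in> E" using fx D by auto
      then have "E = A" using q E by auto
      then have "g ` f ` D \<subseteq> g ` A" using E by auto
      then show ?thesis using homeomorphic_maps_image[OF fg closedin_subset[OF cl[OF D(1)]]] by simp
    qed
    \<comment> \<open>The image of \<open>A\<close> under \<open>g\<close> is irreducible and so
      lies in one member \<open>E\<close>. Then \<open>E\<close> contains every member through
      \<open>x\<close>, and irredundancy leaves only \<open>E\<close> itself.\<close>
    obtain E where E: "E \<in> \<F>" "g ` A \<subseteq> E" 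
      using into[OF homeomorphic_maps_irreducible_closed[OF gf]] A F by blast
    have "D = E" if D: "D \<in> \<F>" "x \<in> D" for D
      using irredundant[OF D(1)] *[OF D] E by blast
    then show ?thesis using B by blast
  qed
  \<comment> \<open>\<open>A\<close> and the union of the other members are complementary closed
    sets, so connectedness makes the latter empty.\<close>
  have "closedin T (\<Union>(\<F> - {A}))" using F cl by (intro closedin_Union) auto
  moreover have "A \<inter> \<Union>(\<F> - {A}) = {}" using disj A by blast
  moreover have "A \<union> \<Union>(\<F> - {A}) = topspace T" using F A by blast
  ultimately have "\<Union>(\<F> - {A}) = {}"
    using T(2) cl[OF A] q(1) unfolding connected_space_closedin_eq by blast
  with \<open>A \<union> \<Union>(\<F> - {A}) = topspace T\<close> have "A = topspace T" by (simp only: Un_empty_right)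
  then show ?thesis using A F by auto
qed

section \<open>Spaces with affine coordinates\<close>

text \<open>The map \<open>\<phi>\<close> to affine space induces the topology \<open>T\<close>.\<close>

definition affine_coords :: "'a topology \<Rightarrow> nat \<Rightarrow> ('a \<Rightarrow> nat \<Rightarrow> complex) \<Rightarrow> bool" where
  "affine_coords T n \<phi> \<longleftrightarrow>
     (\<forall>p\<in>poly_funs n. openin T {x \<in> topspace T. p (\<phi> x) \<noteq> 0}) \<and>
     (\<forall>U x. openin T U \<and> x \<in> U \<longrightarrow>
        (\<exists>p\<in>poly_funs n. p (\<phi> x) \<noteq> 0 \<and> {y \<in> topspace T. p (\<phi> y) \<noteq> 0} \<subseteq> U))"

lemma affine_coords_closedin:
  assumes "affine_coords T n \<phi>" "p \<in> poly_funs n"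
  shows "closedin T {x \<in> topspace T. p (\<phi> x) = 0}"
proof -
  have "openin T {x \<in> topspace T. p (\<phi> x) \<noteq> 0}" using assms by (auto simp: affine_coords_def)
  moreover have "topspace T - {x \<in> topspace T. p (\<phi> x) = 0} = {x \<in> topspace T. p (\<phi> x) \<noteq> 0}" by auto
  ultimately show ?thesis by (simp add: closedin_def)
qed

lemma affine_coords_separate:
  assumes "affine_coords T n \<phi>" "closedin T C" "x \<in> topspace T" "x \<notin> C"
  shows "\<exists>p\<in>poly_funs n. p (\<phi> x) \<noteq> 0 \<and> (\<forall>y\<in>C. p (\<phi> y) = 0)"
proof -
  have "openin T (topspace T - C)" "x \<in> topspace T - C" using assms by auto
  then obtain p where "p \<in> poly_funs n" "p (\<phi> x) \<noteq> 0"
    "{y \<in> topspace T. p (\<phi> y) \<noteq> 0} \<subseteq> topspace T - C"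
    using assms(1) unfolding affine_coords_def by meson
  moreover have "C \<subseteq> topspace T" using assms(2) by (rule closedin_subset)
  ultimately show ?thesis by blast
qed

text \<open>A descending sequence of closed sets has ascending vanishing ideals \<open>V k\<close>.
  Finitely many generators of their union already lie in one \<open>V N\<close>, so the ideals
  stabilise there; the closed sets follow, since polynomials separate a closed set from a point
  outside it.\<close>

lemma noetherian_space_affine_coords:
  assumes T: "affine_coords T n \<phi>"
  shows "noetherian_space T"
  unfolding noetherian_space_def
proof (intro allI impI)
  fix C :: "nat \<Rightarrow> 'a set" assume C: "\<forall>k. closedin T (C k) \<and> C (Suc k) \<subseteq> C k"
  have anti: "C j \<subseteq> C i" if "i \<le> j" for i j
    by (rule lift_Suc_antimono_le[OF _ that]) (use C in blast)
  define V where "V k = {p \<in> poly_funs n. \<forall>x\<in>C k. p (\<phi> x) = 0}" for k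
  have V_mono: "V i \<subseteq> V j" if "i \<le> j" for i j
    using anti[OF that] by (auto simp: V_def)
  have V_ideal: "ideal_gen (poly_funs n) F \<subseteq> V k" if F: "F \<subseteq> V k" for F k
  proof
    fix p assume "p \<in> ideal_gen (poly_funs n) F"
    then show "p \<in> V k"
    proof induction
      case zero
      then show ?case using poly_funs.const[of 0 n] by (simp add: V_def zero_fun_def)
    next
      case (step a r f)
      then have "f \<in> V k" using F by auto
      then have "(\<lambda>x. a x + r x * f x) \<in> poly_funs n"
        using step by (intro poly_funs.add poly_funs.mult) (auto simp: V_def)
      then show ?case using step \<open>f \<in> V k\<close> by (auto simp: V_def)
    qed
  qed
  have finite_V: "\<exists>k. F \<subseteq> V k" if "finite F" "F \<subseteq> (\<Union>k. V k)" for F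
    using that
  proof (induction F rule: finite_induct)
    case (insert f F)
    then obtain i j where "F \<subseteq> V i" "f \<in> V j" by auto
    then have "insert f F \<subseteq> V (max i j)"
      using V_mono[of i "max i j"] V_mono[of j "max i j"] by auto
    then show ?case by blast
  qed auto
  let ?I = "\<Union>k. V k"
  have "ideal_gen (poly_funs n) ?I \<subseteq> ?I"
  proof
    fix p assume "p \<in> ideal_gen (poly_funs n) ?I"
    then show "p \<in> ?I"
    proof induction
      case zero
      then show ?case using V_ideal[of "{}" 0] ideal_gen.zero by blast
    next
      case (step a r f)
      then obtain k where k: "{a, f} \<subseteq> V k" using finite_V[of "{a, f}"] by auto
      have "1 \<in> poly_funs n" using subring_setD(2)[OF subring_set_poly_funs] .
      then have "a + r * f \<in> ideal_gen (poly_funs n) {a, f}"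
        using step by (intro ideal_gen.step ideal_gen_base) auto
      then show ?case using V_ideal[OF k] by blast
    qed
  qed
  moreover have "?I \<subseteq> poly_funs n" by (auto simp: V_def)
  ultimately obtain F where F: "finite F" "F \<subseteq> ?I" "?I \<subseteq> ideal_gen (poly_funs n) F"
    using noetherian_set_poly_funs[of n] unfolding noetherian_set_def
    by (elim allE[of _ ?I]) auto
  then obtain N where N: "F \<subseteq> V N" using finite_V by blast
  have "C k = C N" if k: "k \<ge> N" for k
  proof (rule ccontr)
    assume "C k \<noteq> C N"
    then obtain x where x: "x \<in> C N" "x \<notin> C k" using anti[OF k] by auto
    have "x \<in> topspace T" using x(1) C closedin_subset by blast
    then obtain p where p: "p \<in> poly_funs n" "p (\<phi> x) \<noteq> 0" "\<forall>y\<in>C k. p (\<phi> y) = 0"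
      using affine_coords_separate[OF T _ _ x(2)] C by blast
    then have "p \<in> V k" by (simp add: V_def)
    then have "p \<in> V N" using F(3) V_ideal[OF N] by blast
    then show False using x(1) p(2) by (auto simp: V_def)
  qed
  then show "\<exists>N. \<forall>k\<ge>N. C k = C N" by blast
qed

text \<open>The polynomial functions on an irreducible set form a domain, because the zero sets of
  the two factors cover it.\<close>

lemma irreducible_closed_integral:
  assumes T: "affine_coords T n \<phi>" and Z: "irreducible_closed T Z"
    and p: "p \<in> poly_funs n" "q \<in> poly_funs n"
    and pq: "\<And>x. x \<in> Z \<Longrightarrow> p (\<phi> x) * q (\<phi> x) = 0" and nz: "\<exists>x\<in>Z. p (\<phi> x) \<noteq> 0"
  shows "\<forall>x\<in>Z. q (\<phi> x) = 0"
proof -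
  let ?V = "\<lambda>p. {x \<in> topspace T. p (\<phi> x) = 0}"
  have "Z \<subseteq> ?V p \<union> ?V q"
    using pq closedin_subset[OF irreducible_closedD(1)[OF Z]] by auto
  then have "Z \<subseteq> ?V p \<or> Z \<subseteq> ?V q"
    by (intro irreducible_closed_subset_Un[OF Z] affine_coords_closedin[OF T] p)
  then show ?thesis using nz by blast
qed

section \<open>Algebraic independence along a chain\<close>

lemma sum_PiE_Suc:
  fixes h :: "(nat \<Rightarrow> nat) \<Rightarrow> 'c::comm_monoid_add"
  shows "(\<Sum>a\<in>{..<Suc m} \<rightarrow>\<^sub>E {..N}. h a) = (\<Sum>j\<le>N. \<Sum>a\<in>{..<m} \<rightarrow>\<^sub>E {..N}. h (a(m := j)))"
proof -
  have inj: "inj_on (\<lambda>(j, a). a(m := j)) ({..N} \<times> ({..<m} \<rightarrow>\<^sub>E {..N}))"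
    by (rule inj_combinator) simp
  have "{..<Suc m} \<rightarrow>\<^sub>E {..N} = (\<lambda>(j, a). a(m := j)) ` ({..N} \<times> ({..<m} \<rightarrow>\<^sub>E {..N}))"
    unfolding lessThan_Suc by (rule PiE_insert_eq)
  then have "(\<Sum>a\<in>{..<Suc m} \<rightarrow>\<^sub>E {..N}. h a)
      = (\<Sum>(j, a)\<in>{..N} \<times> ({..<m} \<rightarrow>\<^sub>E {..N}). h (a(m := j)))"
    using sum.reindex[OF inj, of h] by (simp add: case_prod_unfold comp_def)
  then show ?thesis by (simp add: sum.cartesian_product)
qed

text \<open>Functions \<open>p i\<close> that vanish on \<open>Z i\<close> but not on \<open>Z (i + 1)\<close> are algebraically independent:
  cancel the highest possible power of the last one from a relation on \<open>Z m\<close> and restrict the rest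
  to \<open>Z (m - 1)\<close>.\<close>

lemma irreducible_chain_algebraically_independent:
  assumes T: "affine_coords T n \<phi>"
    and "irreducible_chain T m Z"
    and "\<And>i. i < m \<Longrightarrow> p i \<in> poly_funs n"
    and "\<And>i x. i < m \<Longrightarrow> x \<in> Z i \<Longrightarrow> p i (\<phi> x) = 0"
    and "\<And>i. i < m \<Longrightarrow> \<exists>x\<in>Z (Suc i). p i (\<phi> x) \<noteq> 0"
    and "\<And>x. x \<in> Z m \<Longrightarrow> (\<Sum>a\<in>{..<m} \<rightarrow>\<^sub>E {..N}. c a * (\<Prod>i<m. p i (\<phi> x) ^ a i)) = 0"
    and "a \<in> {..<m} \<rightarrow>\<^sub>E {..N}"
  shows "c a = 0"
  using assms(2-)
proof (induction m arbitrary: c a)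
  case 0
  obtain x where "x \<in> Z 0" using 0(1) by (auto simp: irreducible_chain_def irreducible_closed_def)
  then show ?case using 0(5)[of x] 0(6) by simp
next
  case (Suc m)
  \<comment> \<open>The coefficient of \<open>p m ^ j\<close> when the relation is sorted by powers
    of \<open>p m\<close>.\<close>
  define g where "g j y = (\<Sum>a\<in>{..<m} \<rightarrow>\<^sub>E {..N}. c (a(m := j)) * (\<Prod>i<m. p i y ^ a i))" for j y
  have g_poly: "g j \<in> poly_funs n" for j
    unfolding g_def using Suc.prems(2)
    by (intro poly_funs_sum poly_funs.mult poly_funs.const poly_funs_prod poly_funs_power) auto
  have pm: "p m \<in> poly_funs n" using Suc.prems(2) by simp
  \<comment> \<open>The induction hypothesis for the shorter chain: if \<open>g j\<close> vanishes
    on \<open>Z m\<close>, all its coefficients are zero.\<close>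
  have slice: "c (a(m := j)) = 0"
    if "\<And>x. x \<in> Z m \<Longrightarrow> g j (\<phi> x) = 0" "a \<in> {..<m} \<rightarrow>\<^sub>E {..N}" for j a
    using that Suc.prems(1-4) irreducible_chain_take[OF Suc.prems(1), of m]
    by (intro Suc.IH[of "\<lambda>a. c (a(m := j))"]) (auto simp: g_def)
  have rel: "(\<Sum>j\<le>N. g j (\<phi> x) * p m (\<phi> x) ^ j) = 0" if x: "x \<in> Z (Suc m)" for x
  proof -
    have "(\<Prod>i<Suc m. p i (\<phi> x) ^ (a(m := j)) i) = (\<Prod>i<m. p i (\<phi> x) ^ a i) * p m (\<phi> x) ^ j"
      for a :: "nat \<Rightarrow> nat" and j by simp
    then show ?thesis
      using Suc.prems(5)[OF x] unfolding sum_PiE_Suc g_def sum_distrib_right by (simp add: mult.assoc)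
  qed
  have g0: "\<forall>x\<in>Z m. g k (\<phi> x) = 0" if k: "k \<le> N" for k
    using k
  proof (induction k rule: less_induct)
    case (less k)
    \<comment> \<open>The lower coefficients are zero as numbers, so these \<open>g j\<close> vanish
      everywhere and not just on \<open>Z m\<close>. Hence the relation on \<open>Z (Suc m)\<close>
      is divisible by \<open>p m ^ k\<close>.\<close>
    have gj: "g j y = 0" if "j < k" for j y
    proof -
      have "c (a(m := j)) = 0" if "a \<in> {..<m} \<rightarrow>\<^sub>E {..N}" for a
        using slice[of j a] less.IH[of j] less.prems \<open>j < k\<close> that by auto
      then show ?thesis by (simp add: g_def)
    qed
    define q where "q y = (\<Sum>j\<in>{k..N}. g j y * p m y ^ (j - k))" for y
    have q_poly: "q \<in> poly_funs n"
      unfolding q_def by (intro poly_funs_sum poly_funs.mult g_poly poly_funs_power pm)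
    have "p m (\<phi> x) ^ k * q (\<phi> x) = 0" if x: "x \<in> Z (Suc m)" for x
    proof -
      have "p m (\<phi> x) ^ k * q (\<phi> x) = (\<Sum>j\<in>{k..N}. g j (\<phi> x) * p m (\<phi> x) ^ j)"
        unfolding q_def sum_distrib_left
        by (intro sum.cong refl) (simp add: power_add[symmetric] mult.left_commute)
      also have "\<dots> = (\<Sum>j\<le>N. g j (\<phi> x) * p m (\<phi> x) ^ j)"
        using gj by (intro sum.mono_neutral_left) auto
      finally show ?thesis using rel[OF x] by simp
    qed
    moreover have "\<exists>x\<in>Z (Suc m). p m (\<phi> x) ^ k \<noteq> 0" using Suc.prems(4)[of m] by auto
    moreover have "irreducible_closed T (Z (Suc m))" "Z m \<subseteq> Z (Suc m)"
      using Suc.prems(1) by (auto simp: irreducible_chain_def)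
    ultimately have q0: "\<forall>x\<in>Z m. q (\<phi> x) = 0"
      using irreducible_closed_integral[OF T _ poly_funs_power[OF pm, of k] q_poly, of "Z (Suc m)"]
      by blast
    \<comment> \<open>On \<open>Z m\<close> the function \<open>p m\<close> is zero, so only the
      term \<open>j = k\<close> of \<open>q\<close> survives, by \<open>0 ^ 0 = 1\<close>.\<close>
    show ?case
    proof
      fix x assume x: "x \<in> Z m"
      have "q (\<phi> x) = (\<Sum>j\<in>{k}. g j (\<phi> x) * p m (\<phi> x) ^ (j - k))"
        unfolding q_def using less.prems Suc.prems(3)[of m x] x
        by (intro sum.mono_neutral_right) auto
      then show "g k (\<phi> x) = 0" using q0 x by simp
    qed
  qed
  have "a \<in> (\<lambda>(j, a). a(m := j)) ` ({..N} \<times> ({..<m} \<rightarrow>\<^sub>E {..N}))"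
    using Suc.prems(6) unfolding lessThan_Suc PiE_insert_eq by simp
  then obtain j a' where "j \<le> N" "a' \<in> {..<m} \<rightarrow>\<^sub>E {..N}" "a = a'(m := j)" by auto
  then show ?case using slice g0 by blast
qed

subsection \<open>Counting monomials\<close>

interpretation fun_vs: vector_space "\<lambda>(c :: complex) (f :: (nat \<Rightarrow> complex) \<Rightarrow> complex) x. c * f x"
  by unfold_locales (auto simp: fun_eq_iff algebra_simps)

lemma sum_fun_apply: "(\<Sum>a\<in>A. f a) x = (\<Sum>a\<in>A. f a x)"
  for f :: "'b \<Rightarrow> 'x \<Rightarrow> complex"
  by (induction A rule: infinite_finite_induct) auto

text \<open>The library notion of dependence concerns sets, not families. A repeated value of
  \<open>g\<close> is therefore treated separately, with coefficients 1 and -1.\<close>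

lemma linear_dependence:
  assumes "finite A" "finite B" "card B < card A" "g ` A \<subseteq> fun_vs.span B"
  shows "\<exists>c. (\<exists>a\<in>A. c a \<noteq> 0) \<and> (\<forall>x. (\<Sum>a\<in>A. c a * g a x) = 0)"
proof (cases "inj_on g A")
  case True
  have "fun_vs.dependent (g ` A)"
    using fun_vs.independent_span_bound[OF assms(2) _ assms(4)] card_image[OF True] assms(3) by auto
  then obtain u where u: "\<exists>v\<in>g ` A. u v \<noteq> 0" "(\<Sum>v\<in>g ` A. (\<lambda>x. u v * v x)) = 0"
    using fun_vs.dependent_finite[of "g ` A"] assms(1) by auto
  have "(\<Sum>a\<in>A. u (g a) * g a x) = 0" for x
    using fun_cong[OF u(2), of x] by (simp add: sum.reindex[OF True] sum_fun_apply)
  then show ?thesis using u(1) by (intro exI[of _ "u \<circ> g"]) auto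
next
  case False
  then obtain a b where ab: "a \<in> A" "b \<in> A" "a \<noteq> b" "g a = g b" by (auto simp: inj_on_def)
  let ?c = "\<lambda>e. if e = a then 1 else if e = b then - 1 else (0 :: complex)"
  have "(\<Sum>e\<in>A. ?c e * g e x) = (\<Sum>e\<in>{a, b}. ?c e * g e x)" for x
    using ab assms(1) by (intro sum.mono_neutral_right) auto
  then have "(\<Sum>e\<in>A. ?c e * g e x) = 0" for x using ab by simp
  then show ?thesis using ab(1) by (intro exI[of _ ?c]) (auto intro!: bexI[of _ a])
qed

definition monomial :: "nat \<Rightarrow> (nat \<Rightarrow> nat) \<Rightarrow> (nat \<Rightarrow> complex) \<Rightarrow> complex" where
  "monomial n a = (\<lambda>x. \<Prod>i<n. x i ^ a i)"

text \<open>The degree is bounded in each variable separately rather than in total, so that the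
  exponents form a function space with (D + 1)^n elements.\<close>

definition polys_of_box :: "nat \<Rightarrow> nat \<Rightarrow> ((nat \<Rightarrow> complex) \<Rightarrow> complex) set" where
  "polys_of_box n D = fun_vs.span (monomial n ` ({..<n} \<rightarrow>\<^sub>E {..D}))"

lemma polys_of_box_mono: "D \<le> E \<Longrightarrow> polys_of_box n D \<subseteq> polys_of_box n E"
  unfolding polys_of_box_def by (intro fun_vs.span_mono image_mono PiE_mono) auto

lemma monomial_in_polys_of_box:
  assumes "\<And>i. i < n \<Longrightarrow> a i \<le> D"
  shows "monomial n a \<in> polys_of_box n D"
proof -
  \<comment> \<open>Members of an extensional function space are \<open>undefined\<close> off the
    index set, hence the restriction.\<close>
  have "monomial n a = monomial n (restrict a {..<n})" by (simp add: monomial_def)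
  also have "\<dots> \<in> polys_of_box n D"
    unfolding polys_of_box_def using assms by (intro fun_vs.span_base imageI restrict_PiE_iff[THEN iffD2]) auto
  finally show ?thesis .
qed

lemma polys_of_box_const: "(\<lambda>_. c) \<in> polys_of_box n D"
  using fun_vs.span_scale[OF monomial_in_polys_of_box[unfolded polys_of_box_def], of n "\<lambda>_. 0" D c]
  by (simp add: polys_of_box_def monomial_def)

lemma polys_of_box_mult:
  assumes "p \<in> polys_of_box n D" "q \<in> polys_of_box n E"
  shows "(\<lambda>x. p x * q x) \<in> polys_of_box n (D + E)"
proof -
  \<comment> \<open>For a fixed factor the claim is linear in the other one, so two inductions over
    spans reduce both factors to monomials.\<close>
  have sub: "fun_vs.subspace {p. (\<lambda>x. p x * q x) \<in> polys_of_box n F}" for q F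
    unfolding fun_vs.subspace_def
  proof (safe)
    show "(\<lambda>x. 0 x * q x) \<in> polys_of_box n F" using polys_of_box_const[of 0] by simp
  next
    fix p p' assume "(\<lambda>x. p x * q x) \<in> polys_of_box n F" "(\<lambda>x. p' x * q x) \<in> polys_of_box n F"
    then have "(\<lambda>x. p x * q x) + (\<lambda>x. p' x * q x) \<in> polys_of_box n F"
      unfolding polys_of_box_def by (rule fun_vs.span_add)
    then show "(\<lambda>x. (p + p') x * q x) \<in> polys_of_box n F" by (simp add: plus_fun_def distrib_right)
  next
    fix c p assume "(\<lambda>x. p x * q x) \<in> polys_of_box n F"
    then have "(\<lambda>x. c * (p x * q x)) \<in> polys_of_box n F"
      unfolding polys_of_box_def by (rule fun_vs.span_scale)
    then show "(\<lambda>x. c * p x * q x) \<in> polys_of_box n F" by (simp add: mult.assoc)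
  qed
  have mono: "(\<lambda>x. monomial n a x * monomial n b x) \<in> polys_of_box n (D + E)"
    if "a \<in> {..<n} \<rightarrow>\<^sub>E {..D}" "b \<in> {..<n} \<rightarrow>\<^sub>E {..E}" for a b
  proof -
    have "(\<lambda>x. monomial n a x * monomial n b x) = monomial n (\<lambda>i. a i + b i)"
      by (simp add: monomial_def power_add prod.distrib)
    also have "\<dots> \<in> polys_of_box n (D + E)"
      using that by (intro monomial_in_polys_of_box add_mono) (auto simp: PiE_iff)
    finally show ?thesis .
  qed
  have "(\<lambda>x. p x * monomial n b x) \<in> polys_of_box n (D + E)"
    if b: "b \<in> {..<n} \<rightarrow>\<^sub>E {..E}" for b
    using fun_vs.span_induct[OF assms(1)[unfolded polys_of_box_def] sub[of "monomial n b" "D + E"]]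
      mono b by blast
  then have "(\<lambda>x. monomial n b x * p x) \<in> polys_of_box n (D + E)"
    if "b \<in> {..<n} \<rightarrow>\<^sub>E {..E}" for b using that by (simp add: mult.commute)
  then have "(\<lambda>x. q x * p x) \<in> polys_of_box n (D + E)"
    using fun_vs.span_induct[OF assms(2)[unfolded polys_of_box_def] sub[of p "D + E"]] by blast
  then show ?thesis by (simp add: mult.commute)
qed

lemma polys_of_box_power: "p \<in> polys_of_box n D \<Longrightarrow> (\<lambda>x. p x ^ k) \<in> polys_of_box n (k * D)"
proof (induction k)
  case (Suc k)
  then show ?case using polys_of_box_mult[of p n D "\<lambda>x. p x ^ k" "k * D"] by simp
qed (simp add: polys_of_box_const)

lemma polys_of_box_prod:
  "(\<And>i. i < k \<Longrightarrow> p i \<in> polys_of_box n D) \<Longrightarrow> (\<lambda>x. \<Prod>i<k. p i x) \<in> polys_of_box n (k * D)"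
proof (induction k)
  case (Suc k)
  then show ?case
    using polys_of_box_mult[of "\<lambda>x. \<Prod>i<k. p i x" n "k * D" "p k" D] by (simp add: add.commute)
qed (simp add: polys_of_box_const)

lemma poly_funs_in_polys_of_box: "p \<in> poly_funs n \<Longrightarrow> \<exists>D. p \<in> polys_of_box n D"
proof (induction rule: poly_funs.induct)
  case (const c)
  then show ?case using polys_of_box_const by blast
next
  case (coord i)
  have "(\<Prod>j<n. x j ^ (if j = i then 1 else 0)) = (\<Prod>j\<in>{i}. x j)" for x :: "nat \<Rightarrow> complex"
    using coord by (intro prod.mono_neutral_cong_right) auto
  then have "monomial n (\<lambda>j. if j = i then 1 else 0) = (\<lambda>x. x i)"
    by (simp add: monomial_def)
  then show ?case
    using monomial_in_polys_of_box[of n "\<lambda>j. if j = i then 1 else 0" 1] by (intro exI[of _ 1]) simp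
next
  case (add p q)
  then obtain D E where "p \<in> polys_of_box n D" "q \<in> polys_of_box n E" by auto
  then have "p \<in> polys_of_box n (max D E)" "q \<in> polys_of_box n (max D E)"
    using polys_of_box_mono[of D "max D E" n] polys_of_box_mono[of E "max D E" n] by auto
  then have "p + q \<in> polys_of_box n (max D E)"
    unfolding polys_of_box_def by (rule fun_vs.span_add)
  then show ?case unfolding plus_fun_def by blast
next
  case (mult p q)
  then show ?case using polys_of_box_mult by blast
qed

theorem irreducible_chain_bound:
  assumes T: "affine_coords T n \<phi>" and Z: "irreducible_chain T m Z"
  shows "m \<le> n"
proof (rule ccontr)
  assume "\<not> m \<le> n"
  then have Z: "irreducible_chain T (Suc n) Z" using irreducible_chain_take[OF Z] by simp
  have "\<exists>p. p \<in> poly_funs n \<and> (\<forall>x\<in>Z i. p (\<phi> x) = 0) \<and> (\<exists>x\<in>Z (Suc i). p (\<phi> x) \<noteq> 0)"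
    if i: "i < Suc n" for i
  proof -
    have Zi: "irreducible_closed T (Z i)" "irreducible_closed T (Z (Suc i))" "Z i \<subset> Z (Suc i)"
      using Z i by (auto simp: irreducible_chain_def)
    then obtain x where x: "x \<in> Z (Suc i)" "x \<notin> Z i" by blast
    then have "x \<in> topspace T" using closedin_subset[OF irreducible_closedD(1)[OF Zi(2)]] by blast
    then show ?thesis
      using affine_coords_separate[OF T irreducible_closedD(1)[OF Zi(1)] _ x(2)] x(1) by blast
  qed
  then obtain p where p: "\<And>i. i < Suc n \<Longrightarrow> p i \<in> poly_funs n"
    "\<And>i x. i < Suc n \<Longrightarrow> x \<in> Z i \<Longrightarrow> p i (\<phi> x) = 0"
    "\<And>i. i < Suc n \<Longrightarrow> \<exists>x\<in>Z (Suc i). p i (\<phi> x) \<noteq> 0"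
    by metis
  obtain d where d: "\<And>i. i < Suc n \<Longrightarrow> p i \<in> polys_of_box n (d i)"
    using poly_funs_in_polys_of_box[OF p(1)] by metis
  define D where "D = (\<Sum>i<Suc n. d i)"
  have "d i \<le> D" if "i < Suc n" for i
    unfolding D_def using that by (intro member_le_sum) auto
  then have pD: "p i \<in> polys_of_box n D" if "i < Suc n" for i
    using d[OF that] polys_of_box_mono[of "d i" D n] that by auto
  \<comment> \<open>Chosen to beat the growth of the box. With K = (n + 1) D + 1 and N = K^n one has
    M + 1 \<le> K (N + 1), so there are at most N (N + 1)^n monomials, fewer than the (N + 1)^(n +
    1) exponent vectors.\<close>
  define N where "N = (Suc n * D + 1) ^ n"
  define M where "M = Suc n * (N * D)"
  let ?A = "{..<Suc n} \<rightarrow>\<^sub>E {..N}" and ?B = "monomial n ` ({..<n} \<rightarrow>\<^sub>E {..M})"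
  define g where "g a = (\<lambda>x. \<Prod>i<Suc n. p i x ^ a i)" for a :: "nat \<Rightarrow> nat"
  have "g a \<in> fun_vs.span ?B" if a: "a \<in> ?A" for a
  proof -
    have "(\<lambda>x. p i x ^ a i) \<in> polys_of_box n (N * D)" if i: "i < Suc n" for i
    proof -
      have "a i * D \<le> N * D" using a i by (intro mult_right_mono) (auto simp: PiE_iff)
      then show ?thesis
        using polys_of_box_power[OF pD[OF i], of "a i"] polys_of_box_mono[of "a i * D" "N * D" n] by auto
    qed
    then have "g a \<in> polys_of_box n M" unfolding g_def M_def by (rule polys_of_box_prod)
    then show ?thesis by (simp add: polys_of_box_def)
  qed
  moreover have "card ?B < card ?A"
  proof -
    have "card ?B \<le> card ({..<n} \<rightarrow>\<^sub>E {..M})" by (intro card_image_le finite_PiE) auto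
    also have "\<dots> = (M + 1) ^ n" by (simp add: card_PiE)
    also have "\<dots> \<le> ((Suc n * D + 1) * (N + 1)) ^ n"
      unfolding M_def by (intro power_mono) (auto simp: algebra_simps)
    also have "\<dots> = N * (N + 1) ^ n" by (simp only: power_mult_distrib N_def)
    also have "\<dots> < (N + 1) ^ Suc n" by simp
    also have "\<dots> = card ?A" by (simp add: card_PiE del: PiE_insert_eq)
    finally show ?thesis .
  qed
  moreover have "finite ?A" "finite ?B" by (auto intro!: finite_PiE)
  ultimately obtain c where c: "\<exists>a\<in>?A. c a \<noteq> 0" "\<And>x. (\<Sum>a\<in>?A. c a * g a x) = 0"
    using linear_dependence[of ?A ?B g] by blast
  have "c a = 0" if "a \<in> ?A" for a
    using irreducible_chain_algebraically_independent[OF T Z p, where N = N and c = c and a = a] c(2) that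
    by (simp add: g_def)
  then show False using c(1) by blast
qed

section \<open>Varieties\<close>

lemma topspace_zariski: "topspace (zariski n) = affine_space n"
proof -
  have "affine_space n = {x \<in> affine_space n. (\<lambda>_. 1 :: complex) x \<noteq> 0}" by simp
  then have "affine_space n \<in> {{x \<in> affine_space n. p x \<noteq> 0} | p. p \<in> poly_funs n}"
    using poly_funs.const[of 1 n] by (intro CollectI exI[of _ "\<lambda>_. 1"] conjI)
  then show ?thesis unfolding zariski_def topology_generated_by_topspace by blast
qed

lemma openin_zariski_nonvanishing:
  "p \<in> poly_funs n \<Longrightarrow> openin (zariski n) {x \<in> affine_space n. p x \<noteq> 0}"
  unfolding zariski_def by (intro topology_generated_by_Basis) blast

text \<open>Products of polynomials realise intersections of nonvanishing loci, so the generating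
  sets already form a basis.\<close>

lemma openin_zariski_basis:
  assumes "openin (zariski n) U" "x \<in> U"
  shows "\<exists>p\<in>poly_funs n. p x \<noteq> 0 \<and> {y \<in> affine_space n. p y \<noteq> 0} \<subseteq> U"
proof -
  have "generate_topology_on {{x \<in> affine_space n. p x \<noteq> 0} | p. p \<in> poly_funs n} U"
    using assms(1) by (simp add: zariski_def openin_topology_generated_by_iff)
  then show ?thesis
    using assms(2)
  proof (induction arbitrary: x)
    case (Int A B)
    then obtain p q where "p \<in> poly_funs n" "p x \<noteq> 0" "{y \<in> affine_space n. p y \<noteq> 0} \<subseteq> A"
      "q \<in> poly_funs n" "q x \<noteq> 0" "{y \<in> affine_space n. q y \<noteq> 0} \<subseteq> B" by blast
    then show ?case by (intro bexI[of _ "\<lambda>x. p x * q x"] poly_funs.mult) auto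
  next
    case (UN K)
    then obtain A where "A \<in> K" "x \<in> A" by blast
    with UN.IH[of A x] show ?case by blast
  qed auto
qed

text \<open>An isomorphism with an affine model is a homeomorphism onto a closed subset of affine
  space, and the basis of nonvanishing loci is pulled back along it.\<close>

lemma affine_variety_coords:
  assumes "affine_variety Y"
  shows "\<exists>n \<phi>. affine_coords (top_of Y) n \<phi>"
proof -
  let ?T = "top_of Y"
  obtain n V \<phi> \<psi> where V: "closedin (zariski n) V"
    and \<phi>: "continuous_map ?T (subtopology (zariski n) V) \<phi>"
    and \<psi>: "continuous_map (subtopology (zariski n) V) ?T \<psi>"
    and inv: "\<forall>x\<in>topspace ?T. \<psi> (\<phi> x) = x"
    using assms unfolding affine_variety_def isomorphic_def morphism_def affine_model_def by auto
  have VA: "V \<subseteq> affine_space n" using closedin_subset[OF V] by (simp add: topspace_zariski)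
  have \<phi>V: "\<phi> x \<in> V" if "x \<in> topspace ?T" for x
    using continuous_map_image_subset_topspace[OF \<phi>] that by auto
  have "affine_coords ?T n \<phi>"
    unfolding affine_coords_def
  proof (intro conjI ballI allI impI)
    fix p assume p: "p \<in> poly_funs n"
    have "openin (subtopology (zariski n) V) ({x \<in> affine_space n. p x \<noteq> 0} \<inter> V)"
      using openin_zariski_nonvanishing[OF p] unfolding openin_subtopology by blast
    then have "openin ?T {x \<in> topspace ?T. \<phi> x \<in> {x \<in> affine_space n. p x \<noteq> 0} \<inter> V}"
      by (rule openin_continuous_map_preimage[OF \<phi>])
    moreover have "{x \<in> topspace ?T. \<phi> x \<in> {x \<in> affine_space n. p x \<noteq> 0} \<inter> V}
        = {x \<in> topspace ?T. p (\<phi> x) \<noteq> 0}" using \<phi>V VA by blast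
    ultimately show "openin ?T {x \<in> topspace ?T. p (\<phi> x) \<noteq> 0}" by simp
  next
    fix U x assume Ux: "openin ?T U \<and> x \<in> U"
    then have xT: "x \<in> topspace ?T" using openin_subset by blast
    have "openin (subtopology (zariski n) V) {y \<in> topspace (subtopology (zariski n) V). \<psi> y \<in> U}"
      using Ux openin_continuous_map_preimage[OF \<psi>] by blast
    then obtain W where W: "openin (zariski n) W"
      "{y \<in> topspace (subtopology (zariski n) V). \<psi> y \<in> U} = W \<inter> V"
      unfolding openin_subtopology by blast
    have top: "topspace (subtopology (zariski n) V) = V" using VA by (auto simp: topspace_zariski)
    have "\<phi> x \<in> W \<inter> V" unfolding W(2)[symmetric] top using \<phi>V xT inv Ux by auto
    then obtain p where p: "p \<in> poly_funs n" "p (\<phi> x) \<noteq> 0" "{y \<in> affine_space n. p y \<noteq> 0} \<subseteq> W"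
      using openin_zariski_basis[OF W(1)] by blast
    have "y \<in> U" if y: "y \<in> topspace ?T" "p (\<phi> y) \<noteq> 0" for y
    proof -
      have "\<phi> y \<in> W \<inter> V" using p(3) y \<phi>V[OF y(1)] VA by blast
      then have "\<psi> (\<phi> y) \<in> U" unfolding W(2)[symmetric] by blast
      then show ?thesis using inv y(1) by simp
    qed
    then show "\<exists>p\<in>poly_funs n. p (\<phi> x) \<noteq> 0 \<and> {y \<in> topspace ?T. p (\<phi> y) \<noteq> 0} \<subseteq> U"
      using p by blast
  qed
  then show ?thesis by blast
qed

lemma prevariety_cover:
  assumes "prevariety X"
  obtains \<U> where "finite \<U>" "\<Union>\<U> = topspace (top_of X)" "\<And>U. U \<in> \<U> \<Longrightarrow> openin (top_of X) U"
    "\<And>U. U \<in> \<U> \<Longrightarrow> affine_variety (open_subspace X U)"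
    "\<And>U. U \<in> \<U> \<Longrightarrow> \<exists>n \<phi>. affine_coords (subtopology (top_of X) U) n \<phi>"
proof -
  obtain \<U> where U: "finite \<U>" "\<Union>\<U> = topspace (top_of X)"
    "\<And>U. U \<in> \<U> \<Longrightarrow> openin (top_of X) U \<and> affine_variety (open_subspace X U)"
    using assms unfolding prevariety_def by blast
  moreover have "\<exists>n \<phi>. affine_coords (subtopology (top_of X) U) n \<phi>" if "U \<in> \<U>" for U
    using affine_variety_coords[of "open_subspace X U"] U(3)[OF that] by (simp add: open_subspace_def)
  ultimately show thesis using that[of \<U>] by blast
qed

lemma noetherian_space_prevariety:
  assumes "prevariety X"
  shows "noetherian_space (top_of X)"
proof -
  obtain \<U> where "finite \<U>" "\<Union>\<U> = topspace (top_of X)"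
    "\<And>U. U \<in> \<U> \<Longrightarrow> \<exists>n \<phi>. affine_coords (subtopology (top_of X) U) n \<phi>"
    using prevariety_cover[OF assms] by metis
  then show ?thesis using noetherian_space_cover noetherian_space_affine_coords by metis
qed

text \<open>The smallest member of a chain meets some chart, and the traces on that chart form a
  chain of the same length. Finitely many charts give a common bound.\<close>

lemma prevariety_chain_bound:
  assumes "prevariety X"
  shows "\<exists>B. \<forall>m Z. irreducible_chain (top_of X) m Z \<longrightarrow> m \<le> B"
proof -
  obtain \<U> where U: "finite \<U>" "\<Union>\<U> = topspace (top_of X)" "\<And>U. U \<in> \<U> \<Longrightarrow> openin (top_of X) U"
    "\<And>U. U \<in> \<U> \<Longrightarrow> \<exists>n \<phi>. affine_coords (subtopology (top_of X) U) n \<phi>"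
    using prevariety_cover[OF assms] by metis
  then obtain n \<phi> where n: "\<And>U. U \<in> \<U> \<Longrightarrow> affine_coords (subtopology (top_of X) U) (n U) (\<phi> U)"
    by metis
  have "m \<le> Max (n ` \<U>)" if Z: "irreducible_chain (top_of X) m Z" for m Z
  proof -
    have "irreducible_closed (top_of X) (Z 0)" using Z by (auto simp: irreducible_chain_def)
    then have "Z 0 \<noteq> {}" "Z 0 \<subseteq> \<Union>\<U>"
      unfolding U(2) using irreducible_closedD closedin_subset by blast+
    then obtain V where V: "V \<in> \<U>" "Z 0 \<inter> V \<noteq> {}" by blast
    have "m \<le> n V"
      using irreducible_chain_bound[OF n[OF V(1)] irreducible_chain_Int_open[OF Z U(3)[OF V(1)] V(2)]] .
    also have "\<dots> \<le> Max (n ` \<U>)" using V(1) U(1) by simp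
    finally show ?thesis .
  qed
  then show ?thesis by blast
qed

section \<open>Regular functions and continuity of slices\<close>

lemma space_with_functionsD:
  assumes "space_with_functions X" "openin (top_of X) U"
  shows "(\<lambda>_. c) \<in> regular X U"
    and "f \<in> regular X U \<Longrightarrow> g \<in> regular X U \<Longrightarrow> (\<lambda>x. f x + g x) \<in> regular X U"
    and "f \<in> regular X U \<Longrightarrow> g \<in> regular X U \<Longrightarrow> (\<lambda>x. f x * g x) \<in> regular X U"
    and "f \<in> regular X U \<Longrightarrow> openin (top_of X) W \<Longrightarrow> W \<subseteq> U \<Longrightarrow> f \<in> regular X W"
proof -
  note * = assms(1)[unfolded space_with_functions_def]
  show "(\<lambda>_. c) \<in> regular X U"
    by (rule *[THEN conjunct2, THEN conjunct1, THEN spec, THEN spec, THEN mp, OF assms(2)])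
  show "(\<lambda>x. f x + g x) \<in> regular X U" "(\<lambda>x. f x * g x) \<in> regular X U"
    if "f \<in> regular X U" "g \<in> regular X U"
    using *[THEN conjunct2, THEN conjunct2, THEN conjunct1, THEN spec, THEN spec, THEN spec, THEN mp,
        OF conjI, OF assms(2) conjI, OF that]
    by (rule conjunct1, rule conjunct2)
  show "f \<in> regular X W" if "f \<in> regular X U" "openin (top_of X) W" "W \<subseteq> U"
    by (rule *[THEN conjunct2, THEN conjunct2, THEN conjunct2, THEN conjunct1,
          THEN spec[of _ U], THEN spec, THEN spec, THEN mp]) (intro conjI assms(2) that)
qed

text \<open>This is not among the axioms of \<open>space_with_functions\<close>; it comes from the
  charts. Near a point of a chart a regular function is a quotient p / q, and its nonvanishing locus
  there is that of p.\<close>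

lemma openin_regular_nonvanishing:
  assumes X: "prevariety X" and V: "openin (top_of X) V" and g: "g \<in> regular X V"
  shows "openin (top_of X) {x \<in> V. g x \<noteq> 0}"
  unfolding openin_subopen[of _ "{x \<in> V. g x \<noteq> 0}"]
proof
  let ?T = "top_of X"
  fix x assume "x \<in> {x \<in> V. g x \<noteq> 0}"
  then have x: "x \<in> V" "g x \<noteq> 0" by auto
  obtain U where U: "openin ?T U" "x \<in> U" "affine_variety (open_subspace X U)"
    using prevariety_cover[OF X] openin_subset[OF V] x(1) by (metis UnionE subsetD)
  let ?S = "subtopology ?T U"
  obtain n C \<phi> \<psi> where C: "closedin (zariski n) C"
    and \<phi>: "morphism (open_subspace X U) (affine_model n C) \<phi>"
    and \<psi>: "morphism (affine_model n C) (open_subspace X U) \<psi>"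
    and inv: "\<forall>x\<in>topspace ?S. \<psi> (\<phi> x) = x"
    using U(3) unfolding affine_variety_def isomorphic_def by (auto simp: open_subspace_def)
  let ?A = "subtopology (zariski n) C"
  have \<phi>c: "continuous_map ?S ?A \<phi>"
    using \<phi> by (simp add: morphism_def open_subspace_def affine_model_def)
  have VU: "openin ?S (V \<inter> U)" "openin ?T (V \<inter> U)" using V U(1) by (auto simp: openin_subtopology)
  have "g \<in> regular X (V \<inter> U)"
    using space_with_functionsD(4)[OF _ V g VU(2)] X by (simp add: prevariety_def)
  then have greg: "(\<lambda>y. g (\<psi> y)) \<in> regular (affine_model n C) {y \<in> topspace ?A. \<psi> y \<in> V \<inter> U}"
    using \<psi>[unfolded morphism_def, THEN conjunct2, rule_format, of "V \<inter> U" g] VU(1)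
    by (simp only: open_subspace_def affine_model_def function_space.simps)
  have xS: "x \<in> topspace ?S" using U openin_subset by fastforce
  have "\<phi> x \<in> topspace ?A" using continuous_map_image_subset_topspace[OF \<phi>c] xS by blast
  then have "\<phi> x \<in> {y \<in> topspace ?A. \<psi> y \<in> V \<inter> U}"
    using inv[rule_format, OF xS] x(1) U(2) by simp
  with greg have "\<exists>W. openin ?A W \<and> \<phi> x \<in> W \<and> W \<subseteq> {y \<in> topspace ?A. \<psi> y \<in> V \<inter> U} \<and>
      (\<exists>p\<in>poly_funs n. \<exists>q\<in>poly_funs n. \<forall>y\<in>W. q y \<noteq> 0 \<and> g (\<psi> y) = p y / q y)"
    unfolding affine_model_def function_space.simps mem_Collect_eq[of "\<lambda>y. g (\<psi> y)"] by (rule bspec)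
  then obtain W p q where W: "openin ?A W" "\<phi> x \<in> W" "W \<subseteq> {y \<in> topspace ?A. \<psi> y \<in> V \<inter> U}"
    and p: "p \<in> poly_funs n" and q: "\<forall>y\<in>W. q y \<noteq> 0 \<and> g (\<psi> y) = p y / q y"
    by (elim exE bexE conjE)
  have CA: "C \<subseteq> affine_space n" using closedin_subset[OF C] by (simp add: topspace_zariski)
  have "openin ?A (W \<inter> ({y \<in> affine_space n. p y \<noteq> 0} \<inter> C))"
    by (intro openin_Int W(1) openin_subtopology_Int openin_zariski_nonvanishing p)
  then have "openin ?S {z \<in> topspace ?S. \<phi> z \<in> W \<inter> ({y \<in> affine_space n. p y \<noteq> 0} \<inter> C)}"
    (is "openin _ ?O")
    by (rule openin_continuous_map_preimage[OF \<phi>c])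
  then have "openin ?T ?O" using openin_trans_full U(1) by blast
  moreover have "x \<in> ?O"
  proof -
    have "g x = p (\<phi> x) / q (\<phi> x)" using q W(2) inv xS by auto
    then have "p (\<phi> x) \<noteq> 0" using x(2) by auto
    moreover have "\<phi> x \<in> C" using W by auto
    ultimately show ?thesis using CA xS W(2) by blast
  qed
  moreover have "?O \<subseteq> {x \<in> V. g x \<noteq> 0}"
  proof
    fix z assume z: "z \<in> ?O"
    then have "\<phi> z \<in> W" "p (\<phi> z) \<noteq> 0" "\<psi> (\<phi> z) = z" using inv by auto
    then show "z \<in> {x \<in> V. g x \<noteq> 0}" using W(3) q by auto
  qed
  ultimately show "\<exists>W. openin ?T W \<and> x \<in> W \<and> W \<subseteq> {x \<in> V. g x \<noteq> 0}" by blast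
qed

lemma regular_tensor_slice:
  assumes X: "space_with_functions X" and V: "openin (top_of X) V"
    and h: "h \<in> tensor_funs Y X U V"
  shows "(\<lambda>x. h (a, x)) \<in> regular X V"
proof -
  obtain m f g where h': "h = (\<lambda>(x, y). \<Sum>i<(m::nat). f i x * g i y)" and g: "\<forall>i<m. g i \<in> regular X V"
    using h unfolding tensor_funs_def by blast
  have "(\<lambda>x. \<Sum>i<k. f i a * g i x) \<in> regular X V" if "k \<le> m" for k
    using that
  proof (induction k)
    case 0
    show ?case using space_with_functionsD(1)[OF X V, of 0] by simp
  next
    case (Suc k)
    then have "(\<lambda>x. (\<Sum>i<k. f i a * g i x) + f k a * g k x) \<in> regular X V"
      using g by (intro space_with_functionsD(1-3)[OF X V]) auto
    then show ?case by simp
  qed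
  from this[of m] show ?thesis by (simp add: h')
qed

text \<open>Continuity is tested on the generating open sets. Fixing the first variable in a tensor
  function leaves a regular function, so the preimages are nonvanishing loci or empty.\<close>

lemma continuous_map_variety_product_slice:
  assumes X: "prevariety X" and Y: "space_with_functions Y" and a: "a \<in> topspace (top_of Y)"
  shows "continuous_map (top_of X) (top_of (variety_product Y X)) (\<lambda>x. (a, x))"
proof -
  have X': "space_with_functions X" using X by (simp add: prevariety_def)
  let ?B = "{{z \<in> U \<times> V. h z \<noteq> 0} | U V h.
    openin (top_of Y) U \<and> openin (top_of X) V \<and> h \<in> tensor_funs Y X U V}"
  have "continuous_map (top_of X) (topology_generated_by ?B) (\<lambda>x. (a, x))"
  proof (rule continuous_on_generated_topo)
    fix W assume "W \<in> ?B"
    then obtain U V h where W: "W = {z \<in> U \<times> V. h z \<noteq> 0}" and V: "openin (top_of X) V"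
      and h: "h \<in> tensor_funs Y X U V" by blast
    have "openin (top_of X) {x \<in> V. h (a, x) \<noteq> 0}"
      by (rule openin_regular_nonvanishing[OF X V regular_tensor_slice[OF X' V h]])
    moreover have "(\<lambda>x. (a, x)) -` W \<inter> topspace (top_of X)
        = (if a \<in> U then {x \<in> V. h (a, x) \<noteq> 0} else {})"
      using openin_subset[OF V] by (auto simp: W)
    ultimately show "openin (top_of X) ((\<lambda>x. (a, x)) -` W \<inter> topspace (top_of X))" by simp
  next
    \<comment> \<open>The map must also land in the union of the generators; the constant function 1
      exhibits the whole product as one of them.\<close>
    let ?U = "topspace (top_of Y)" and ?V = "topspace (top_of X)"
    have one: "(\<lambda>_. 1) \<in> regular Y ?U" "(\<lambda>_. 1) \<in> regular X ?V"
      by (intro space_with_functionsD(1) X' Y openin_topspace)+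
    have "(\<lambda>(x, y). \<Sum>i<(1::nat). 1 * 1) \<in> tensor_funs Y X ?U ?V"
      unfolding tensor_funs_def using one
      by (intro CollectI exI[of _ 1] exI[of _ "\<lambda>_ _. 1"]) auto
    then have "{z \<in> ?U \<times> ?V. (\<lambda>(x, y). \<Sum>i<(1::nat). 1 * 1 :: complex) z \<noteq> 0} \<in> ?B" by blast
    moreover have "{z \<in> ?U \<times> ?V. (\<lambda>(x, y). \<Sum>i<(1::nat). 1 * 1 :: complex) z \<noteq> 0} = ?U \<times> ?V" by auto
    ultimately have "?U \<times> ?V \<in> ?B" by simp
    then show "(\<lambda>x. (a, x)) ` topspace (top_of X) \<subseteq> \<Union>?B" using a by blast
  qed
  then show ?thesis by (simp add: variety_product_def variety_product_topology_def)
qed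

section \<open>Dimensions of connected algebraic subgroups\<close>

lemma (in comm_algebraic_group) continuous_map_translation:
  assumes "a \<in> carrier G"
  shows "continuous_map (top_of X) (top_of X) (\<lambda>x. a \<otimes> x)"
proof -
  have X: "prevariety X" "space_with_functions X" using variety by (auto simp: variety_def prevariety_def)
  have "continuous_map (top_of X) (top_of (variety_product X X)) (\<lambda>x. (a, x))"
    using continuous_map_variety_product_slice[OF X] assms carrier_eq by simp
  moreover have "continuous_map (top_of (variety_product X X)) (top_of X) (\<lambda>(x, y). x \<otimes> y)"
    using mult_morphism by (simp add: morphism_def)
  ultimately show ?thesis
    using continuous_map_compose[of "top_of X" _ "\<lambda>x. (a, x)" _ "\<lambda>(x, y). x \<otimes> y"]
    by (simp add: comp_def)
qed

lemma (in comm_algebraic_group) irreducible_connected_algebraic_subgroup: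
  assumes "connected_algebraic_subgroup G X K"
  shows "irreducible_closed (top_of X) K"
proof -
  have K: "subgroup K G" "closedin (top_of X) K" "connectedin (top_of X) K"
    using assms by (auto simp: connected_algebraic_subgroup_def)
  let ?T = "subtopology (top_of X) K"
  have top: "topspace ?T = K" using closedin_subset[OF K(2)] by auto
  have trans: "continuous_map ?T ?T (\<lambda>x. a \<otimes> x)" if "a \<in> K" for a
  proof (rule continuous_map_into_subtopology)
    show "continuous_map ?T (top_of X) (\<lambda>x. a \<otimes> x)"
      using that subgroup.mem_carrier[OF K(1)]
      by (intro continuous_map_from_subtopology continuous_map_translation)
    show "(\<lambda>x. a \<otimes> x) \<in> topspace ?T \<rightarrow> K"
      unfolding top using that subgroup.m_closed[OF K(1)] by blast
  qed
  have hom: "\<exists>f g. homeomorphic_maps ?T ?T f g \<and> f x = y" if xy: "x \<in> K" "y \<in> K" for x y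
  proof (intro exI conjI)
    \<comment> \<open>Translation by \<open>y \<otimes> inv x\<close> takes \<open>x\<close> to
      \<open>y\<close>, with inverse the translation by \<open>x \<otimes> inv y\<close>; both
      preserve \<open>K\<close>.\<close>
    have *: "x \<otimes> inv y \<in> K" "y \<otimes> inv x \<in> K"
      using xy subgroup.m_closed[OF K(1)] subgroup.m_inv_closed[OF K(1)] by auto
    have c: "z \<in> carrier G" if "z \<in> K" for z using subgroup.mem_carrier[OF K(1) that] .
    have "(x \<otimes> inv y) \<otimes> ((y \<otimes> inv x) \<otimes> z) = z" "(y \<otimes> inv x) \<otimes> ((x \<otimes> inv y) \<otimes> z) = z" if "z \<in> K" for z
    proof -
      have "(x \<otimes> inv y) \<otimes> (y \<otimes> inv x) = \<one>" "(y \<otimes> inv x) \<otimes> (x \<otimes> inv y) = \<one>"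
        using c xy by (metis inv_closed inv_mult_group inv_inv m_closed r_inv)+
      then show "(x \<otimes> inv y) \<otimes> ((y \<otimes> inv x) \<otimes> z) = z" "(y \<otimes> inv x) \<otimes> ((x \<otimes> inv y) \<otimes> z) = z"
        using c[OF that] c[OF *(1)] c[OF *(2)] by (simp_all flip: m_assoc)
    qed
    then show "homeomorphic_maps ?T ?T (\<lambda>z. (y \<otimes> inv x) \<otimes> z) (\<lambda>z. (x \<otimes> inv y) \<otimes> z)"
      unfolding homeomorphic_maps_def top using trans * by simp
    show "(y \<otimes> inv x) \<otimes> x = y" using c xy by (simp add: m_assoc)
  qed
  have "noetherian_space (top_of X)"
    using variety unfolding variety_def by (intro noetherian_space_prevariety) (rule conjunct1)
  then have "noetherian_space ?T" using noetherian_space_closed_subtopology K(2) by blast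
  moreover have "connected_space ?T" using K(3) by (simp add: connectedin_def)
  moreover have "K \<noteq> {}" using subgroup.one_closed[OF K(1)] by blast
  ultimately have "irreducible_closed ?T (topspace ?T)"
    using irreducible_of_homogeneous[of ?T, unfolded top] hom unfolding top by blast
  then show ?thesis unfolding top using irreducible_closed_subtopology[OF K(2)] by blast
qed

section \<open>Strict monotonicity of the dimension\<close>

lemma krull_dim_irreducible_chain:
  assumes "\<forall>m Z. irreducible_chain T m Z \<longrightarrow> m \<le> B"
  shows "irreducible_chain T m Z \<Longrightarrow> m \<le> krull_dim T"
    and "irreducible_closed T Z0 \<Longrightarrow> \<exists>Z. irreducible_chain T (krull_dim T) Z"
proof -
  let ?S = "{n. \<exists>Z. irreducible_chain T n Z}"
  have dim: "krull_dim T = Sup ?S" by (simp add: krull_dim_def irreducible_chain_def)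
  have fin: "finite ?S" using assms by (auto simp: finite_nat_set_iff_bounded_le)
  show "m \<le> krull_dim T" if "irreducible_chain T m Z"
  proof -
    have "m \<in> ?S" using that by blast
    then show ?thesis unfolding dim using fin by (simp add: cSup_eq_Max le_cSup_finite)
  qed
  assume "irreducible_closed T Z0"
  \<comment> \<open>The chain of length 0 makes the set of lengths nonempty, so that its
    \<open>Sup\<close> is attained.\<close>
  then have "irreducible_chain T 0 (\<lambda>_. Z0)" by (simp add: irreducible_chain_def)
  then have "?S \<noteq> {}" by blast
  then have "Sup ?S \<in> ?S" unfolding cSup_eq_Max[OF fin \<open>?S \<noteq> {}\<close>] by (rule Max_in[OF fin])
  then show "\<exists>Z. irreducible_chain T (krull_dim T) Z" unfolding dim by blast
qed

text \<open>A longest chain below \<open>K\<close> is prolonged by \<open>L\<close>, which is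
  irreducible and strictly contains its top. The bound on chains guarantees that a longest one
  exists and that the longer one is counted.\<close>

lemma dimension_strict_mono:
  assumes X: "prevariety X"
    and K: "irreducible_closed (top_of X) K" and L: "irreducible_closed (top_of X) L" and KL: "K \<subset> L"
  shows "dimension X K < dimension X L"
proof -
  obtain B where B: "\<forall>m Z. irreducible_chain (top_of X) m Z \<longrightarrow> m \<le> B"
    using prevariety_chain_bound[OF X] by blast
  have sub: "irreducible_chain (subtopology (top_of X) M) m Z
      \<longleftrightarrow> irreducible_chain (top_of X) m Z \<and> (\<forall>i\<le>m. Z i \<subseteq> M)"
    if "irreducible_closed (top_of X) M" for M m Z
    using irreducible_closed_subtopology[OF irreducible_closedD(1)[OF that]]
    by (auto simp: irreducible_chain_def)
  have bound: "\<forall>m Z. irreducible_chain (subtopology (top_of X) M) m Z \<longrightarrow> m \<le> B"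
    if "irreducible_closed (top_of X) M" for M
    using B sub[OF that] by blast
  have "irreducible_closed (subtopology (top_of X) K) K"
    using irreducible_closed_subtopology[OF irreducible_closedD(1)[OF K]] K by blast
  then obtain Z where "irreducible_chain (subtopology (top_of X) K) (dimension X K) Z"
    using krull_dim_irreducible_chain(2)[OF bound[OF K]] unfolding dimension_def by blast
  then have Z: "irreducible_chain (top_of X) (dimension X K) Z" "\<forall>i\<le>dimension X K. Z i \<subseteq> K"
    using sub[OF K] by auto
  let ?d = "dimension X K"
  have "Z ?d \<subset> L" using Z(2) KL by blast
  then have "irreducible_chain (top_of X) (Suc ?d) (Z(Suc ?d := L))"
    using Z(1) L by (auto simp: irreducible_chain_def le_Suc_eq less_Suc_eq)
  moreover have "\<forall>i\<le>Suc ?d. (Z(Suc ?d := L)) i \<subseteq> L" using Z(2) KL by (auto simp: le_Suc_eq)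
  ultimately have "irreducible_chain (subtopology (top_of X) L) (Suc ?d) (Z(Suc ?d := L))"
    using sub[OF L] by blast
  then show ?thesis
    using krull_dim_irreducible_chain(1)[OF bound[OF L]] unfolding dimension_def by fastforce
qed

section \<open>The slope inequality\<close>

theorem proposition4p4:
  fixes G :: "('a, 'b) monoid_scheme" and X :: "'a function_space"
    and l r :: nat and \<gamma> :: "nat \<Rightarrow> 'a" and S :: "nat \<Rightarrow> real" and H :: "nat \<Rightarrow> 'a set"
  assumes "comm_algebraic_group G X"
    and "connected_space (top_of X)"
    and "0 < dimension X (carrier G)"
    and "\<forall>j\<in>{1..l}. \<gamma> j \<in> carrier G"
    and "\<forall>i j. 1 \<le> i \<and> i \<le> j \<and> j \<le> l \<longrightarrow> S j \<le> S i"
    and "\<forall>j\<in>{1..l}. 1 \<le> S j"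
    and "associated_chain G X l \<gamma> S r H"
  shows "\<forall>i\<in>{1..r - 1}.
    (phi G l \<gamma> S (H (i + 1)) - phi G l \<gamma> S (H i)) /
      (real (dimension X (H (i + 1))) - real (dimension X (H i)))
    < (phi G l \<gamma> S (H i) - phi G l \<gamma> S (H (i - 1))) /
      (real (dimension X (H i)) - real (dimension X (H (i - 1))))"
proof
  interpret comm_algebraic_group G X by fact
  have X: "prevariety X" using variety by (simp add: variety_def)
  have conn: "\<And>i. i \<le> r \<Longrightarrow> connected_algebraic_subgroup G X (H i)"
    and strict: "\<And>i. i < r \<Longrightarrow> H i \<subset> H (i + 1)"
    and slope_le: "\<And>i K. i < r \<Longrightarrow> connected_algebraic_subgroup G X K \<Longrightarrow>
      dimension X (H i) < dimension X K \<Longrightarrow>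
      slope G X l \<gamma> S (H i) K \<le> slope G X l \<gamma> S (H i) (H (i + 1))"
    and slope_eq: "\<And>i K. i < r \<Longrightarrow> connected_algebraic_subgroup G X K \<Longrightarrow>
      dimension X (H i) < dimension X K \<Longrightarrow>
      slope G X l \<gamma> S (H i) K = slope G X l \<gamma> S (H i) (H (i + 1)) \<Longrightarrow> K \<subseteq> H (i + 1)"
    using assms(7) unfolding associated_chain_def by blast+
  have dim: "dimension X (H i) < dimension X (H (i + 1))" if "i < r" for i
    using dimension_strict_mono[OF X] irreducible_connected_algebraic_subgroup conn strict that by simp
  fix i assume "i \<in> {1..r - 1}"
  \<comment> \<open>Writing \<open>i = k + 1\<close> keeps truncated subtraction out of the
    computation.\<close>
  then obtain k where k: "i = k + 1" "k + 1 < r" by (cases i) auto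
  let ?\<phi> = "\<lambda>j. phi G l \<gamma> S (H j)" and ?d = "\<lambda>j. real (dimension X (H j))"
  let ?s = "slope G X l \<gamma> S (H k) (H (k + 1))"
  have d: "?d k < ?d (k + 1)" "?d (k + 1) < ?d (k + 2)" using dim[of k] dim[of "k + 1"] k by auto
  have "slope G X l \<gamma> S (H k) (H (k + 2)) \<noteq> ?s"
    using slope_eq[of k "H (k + 2)"] conn[of "k + 2"] strict[of "k + 1"] d k by auto
  then have "slope G X l \<gamma> S (H k) (H (k + 2)) < ?s"
    using slope_le[of k "H (k + 2)"] conn[of "k + 2"] d k by simp
  \<comment> \<open>Only the slope to \<open>H (k + 2)\<close> is unfolded, so that
    \<open>?s\<close> stays a single factor and the exact increment from \<open>k\<close> to
    \<open>k + 1\<close> can be subtracted.\<close>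
  then have "?\<phi> (k + 2) - ?\<phi> k < ?s * (?d (k + 2) - ?d k)"
    using d unfolding slope_def[of _ _ _ _ _ _ "H (k + 2)"] by (simp add: pos_divide_less_eq)
  moreover have "?\<phi> (k + 1) - ?\<phi> k = ?s * (?d (k + 1) - ?d k)"
    using d by (simp add: slope_def)
  ultimately have "?\<phi> (k + 2) - ?\<phi> (k + 1) < ?s * (?d (k + 2) - ?d (k + 1))"
    by (simp add: algebra_simps)
  then have "(?\<phi> (k + 2) - ?\<phi> (k + 1)) / (?d (k + 2) - ?d (k + 1)) < ?s"
    using d by (simp add: pos_divide_less_eq)
  then show "(?\<phi> (i + 1) - ?\<phi> i) / (?d (i + 1) - ?d i) < (?\<phi> i - ?\<phi> (i - 1)) / (?d i - ?d (i - 1))"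
    by (simp add: k slope_def)
qed

end
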